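(* Assume that the reduced system $G(p,x)\in K$ enjoys Robinson stability at $(\bar p,\bar x)$, and that strict complementarity holds for the system $G(\bar p,x)\in K$ at $(\bar x,\bar x^* )$. Then for every $v=(q,u)\in{\cal P}\times X$, $$D\Psi(\bar p,\bar x,\bar x^* )(v)\subset\bigcup\Big\{\nabla(\nabla_xG(\cdot)^*\hat\mu)(\bar z)v+\pi_{X^*}\big(N_{{\cal K}_{\operatorname{gph}\Gamma}(\bar z,z^* )}(v)\big)\ \Big|\ z^*\in N_{T_{\operatorname{gph}\Gamma}(\bar z)}(v),\ \pi_{X^*}(z^* )=\bar x^*,\ \hat\mu\in{\cal M}(\bar z,z^* )\Big\}.$$ If moreover $\nabla^2G(\bar z)(v,v)\in\operatorname{rge}\nabla G(\bar z)+\operatorname{lin}K$, then this inclusion holds as an equality.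
   Context: Notation: $X=\mathbb R^n$, $P=\mathbb R^m$, $Y=\mathbb R^l$, $Z:=P\times X$, and $E$ is finite-dimensional. Dual spaces are distinguished from primal ones, $Z^*=P^*\times X^*$, and $\pi_{X^*}(p^*,x^* ):=x^*$. $A^*$ denotes the adjoint of a linear map $A$, and $\operatorname{rge}A$ its range. For $\mu\in E^*$, $\nabla(\nabla_xG(\cdot)^*\mu)(\bar z)v\in X^*$ is the derivative at $\bar z$ of the map $z\mapsto\nabla_xG(z)^*\mu$, applied to $v$. For a cone $A$, $A^*:=\{a^*:\langle a^*,a\rangle\le0\ \forall a\in A\}$ is its polar, and for a closed convex cone $K$, $\operatorname{lin}K:=K\cap(-K)$; $\operatorname{ri}$ is the relative interior. For a closed set $\Omega$ and $\bar z\in\Omega$: the tangent cone is $T_\Omega(\bar z):=\{w:\exists\, t_k\downarrow0,\ w_k\to w \text{ with } \bar z+t_kw_k\in\Omega\}$; the regular normal cone is $N_\Omega(\bar z):=\{z^*:\limsup_{z\to\bar z,\,z\in\Omega}\langle z^*,z-\bar z\rangle/\|z-\bar z\|\le0\}$ (for convex sets, this is the normal cone of convex analysis); and, for $z^*\in N_\Omega(\bar z)$, the critical cone is ${\cal K}_\Omega(\bar z,z^* ):=T_\Omega(\bar z)\cap\{z^*\}^\perp$. For a set-valued map $\Phi$, the graphical derivative is $D\Phi(\bar z,\bar u)(w):=\{v:(w,v)\in T_{\operatorname{gph}\Phi}(\bar z,\bar u)\}$. Setting: $g\colon P\times X\to Y$ is $C^2$ around $\bar z=(\bar p,\bar x)$.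 The set $C\subset Y$ is closed and $C^2$-cone reducible at $g(\bar z)$ to a closed convex cone $K\subset E$: there exist a neighborhood $V$ of $g(\bar z)$ and a $C^2$ map $h\colon V\to E$ with $h(g(\bar z))=0$, $\nabla h(g(\bar z))$ surjective, and $C\cap V=\{y\in V:h(y)\in K\}$. Set $\Gamma(p):=\{x:g(p,x)\in C\}$ with $\bar x\in\Gamma(\bar p)$, $\Psi(p,x):=N_{\Gamma(p)}(x)$, and fix $\bar x^*\in N_{\Gamma(\bar p)}(\bar x)$. Let $G:=h\circ g$, defined near $\bar z$, so that $G(\bar z)=0$. Near $\bar z$, $\operatorname{gph}\Gamma$ coincides with $\{z:G(z)\in K\}$, and for $p$ near $\bar p$, $\Gamma(p)$ coincides near $\bar x$ with $\{x:G(p,x)\in K\}$. The system $G(p,x)\in K$ enjoys Robinson stability (RS) at $(\bar p,\bar x)$ if there are $\kappa\ge0$ and neighborhoods $W$ of $\bar p$ and $U$ of $\bar x$ with ${\rm dist}(x;\{x':G(p,x')\in K\})\le\kappa\,{\rm dist}(G(p,x);K)$ for all $(p,x)\in W\times U$. Strict complementarity holds for $G(\bar p,x)\in K$ at $(\bar x,\bar x^* )$ if there is $\mu\in\operatorname{ri}K^*$ with $\nabla_xG(\bar z)^*\mu=\bar x^*$. Multiplier sets: for $z^*\in N_{\operatorname{gph}\Gamma}(\bar z)$, ${\cal M}(\bar z,z^* ):=\{\mu\in K^*:\nabla G(\bar z)^*\mu=z^*\}$. The characteristic subspace is ${\cal P}:=\{q\in P:\nabla_pG(\bar z)q\in\operatorname{rge}\nabla_xG(\bar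 z)+\operatorname{lin}K\}$. *)

theory Defs
  imports "HOL-Analysis.Analysis"
begin

text \<open>Dual spaces are identified with the primal (Euclidean) spaces via the inner product.\<close>

definition D1 :: "('a::euclidean_space \<Rightarrow> 'b::euclidean_space) \<Rightarrow> 'a \<Rightarrow> ('a \<Rightarrow>\<^sub>L 'b)" where
  "D1 f w = Blinfun (frechet_derivative f (at w))"

definition D2 :: "('a::euclidean_space \<Rightarrow> 'b::euclidean_space) \<Rightarrow> 'a \<Rightarrow> 'a \<Rightarrow> ('a \<Rightarrow>\<^sub>L 'b)" where
  "D2 f w = frechet_derivative (D1 f) (at w)"

definition C2_on :: "'a::euclidean_space set \<Rightarrow> ('a \<Rightarrow> 'b::euclidean_space) \<Rightarrow> bool" where
  "C2_on U f \<longleftrightarrow> open U \<and> (\<forall>w\<in>U. f differentiable (at w)) \<and>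
     (\<forall>w\<in>U. (D1 f) differentiable (at w)) \<and> continuous_on U (\<lambda>w. Blinfun (D2 f w))"

definition regular_normal :: "'a::euclidean_space set \<Rightarrow> 'a \<Rightarrow> 'a set" where
  "regular_normal \<Omega> z = (if z \<in> \<Omega> then
     {zs. \<forall>\<epsilon>>0. \<exists>\<delta>>0. \<forall>z'\<in>\<Omega>. dist z' z < \<delta> \<longrightarrow> zs \<bullet> (z' - z) \<le> \<epsilon> * norm (z' - z)}
   else {})"

definition tangent_cone :: "'a::euclidean_space set \<Rightarrow> 'a \<Rightarrow> 'a set" where
  "tangent_cone \<Omega> z = {w. \<exists>t::nat \<Rightarrow> real. \<exists>ws::nat \<Rightarrow> 'a.
      (\<forall>k. t k > 0) \<and> t \<longlonglongrightarrow> 0 \<and> ws \<longlonglongrightarrow> w \<and> (\<forall>k. z + t k *\<^sub>R ws k \<in> \<Omega>)}"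

definition critical_cone :: "'a::euclidean_space set \<Rightarrow> 'a \<Rightarrow> 'a \<Rightarrow> 'a set" where
  "critical_cone \<Omega> z zs = tangent_cone \<Omega> z \<inter> {w. zs \<bullet> w = 0}"

definition polar :: "'a::euclidean_space set \<Rightarrow> 'a set" where
  "polar A = {as. \<forall>a\<in>A. as \<bullet> a \<le> 0}"

definition lin_cone :: "'a::euclidean_space set \<Rightarrow> 'a set" where
  "lin_cone K = K \<inter> uminus ` K"

definition setplus :: "'a::euclidean_space set \<Rightarrow> 'a set \<Rightarrow> 'a set" where
  "setplus A B = {a + b | a b. a \<in> A \<and> b \<in> B}"

definition gph :: "('a \<Rightarrow> 'b set) \<Rightarrow> ('a \<times> 'b) set" where
  "gph \<Phi> = {(z, u). u \<in> \<Phi> z}"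

definition graphical_derivative ::
  "('a::euclidean_space \<Rightarrow> 'b::euclidean_space set) \<Rightarrow> 'a \<Rightarrow> 'b \<Rightarrow> 'a \<Rightarrow> 'b set" where
  "graphical_derivative \<Phi> z u w = {v. (w, v) \<in> tangent_cone (gph \<Phi>) (z, u)}"

text \<open>Robinson stability of G(p,x) \<in> K at (pb,xb), G being defined on the domain D.
  The distance to an empty set is +infinity, hence the nonemptiness requirement.\<close>
definition robinson_stable ::
  "('p::euclidean_space \<times> 'x::euclidean_space \<Rightarrow> 'e::euclidean_space) \<Rightarrow> 'e set \<Rightarrow>
   ('p \<times> 'x) set \<Rightarrow> 'p \<Rightarrow> 'x \<Rightarrow> bool" where
  "robinson_stable G K D pb xb \<longleftrightarrow>
    (\<exists>\<kappa>\<ge>0. \<exists>W U. open W \<and> pb \<in> W \<and> open U \<and> xb \<in> U \<and> W \<times> U \<subseteq> D \<and>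
      (\<forall>p\<in>W. \<forall>x\<in>U. {x'. (p, x') \<in> D \<and> G (p, x') \<in> K} \<noteq> {} \<and>
         infdist x {x'. (p, x') \<in> D \<and> G (p, x') \<in> K} \<le> \<kappa> * infdist (G (p, x)) K))"

end

theory Submission
  imports Defs
begin

text \<open>Write \<open>A\<close> for the derivative of \<open>G\<close> at \<open>zb\<close> and \<open>B u = A (0, u)\<close>. Robinson stability gives bounded
  multipliers for all normals to \<open>\<Gamma> p\<close> near \<open>(pb, xb)\<close>, and it makes the tangent cone of the graph of \<open>\<Gamma>\<close> equal to
  \<open>{w. A w \<in> K}\<close>. Under strict complementarity a direction \<open>v\<close> over the characteristic subspace that
  carries a multiplier satisfies \<open>A v \<in> lin_cone K\<close>, and then the projected normal cone to the critical cone
  at \<open>v\<close> is the orthogonal complement of \<open>{u. B u \<in> lin_cone K}\<close>, whatever the multiplier is.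
  The inclusion follows by passing to the limit in the difference quotients of the multiplier equation:
  tested against \<open>u\<close> with \<open>B u \<in> lin_cone K\<close>, the possibly unbounded difference quotients of the multipliers drop out.
  For equality, the second-order condition yields feasible points whose \<open>G\<close>-value is within \<open>o(t\<^sup>2)\<close>
  of \<open>lin_cone K\<close>, and projecting a shifted point back onto \<open>\<Gamma> p\<close> produces the required normals.\<close>

section \<open>Polar cones, tangents and regular normals\<close>

text \<open>A normal may have many multipliers, and nothing supplies a rate at which multipliers
  along a sequence approach a limit. Hence no derivative is ever taken in the multiplier. The
  forward half uses only boundedness of multipliers. The converse half never identifies a multiplier
  of the projected point; it bounds the displacement \<open>d\<close> of the projection by pairing
  it with one explicitly built element of \<open>polar K\<close>. Both halves rest on one fact: the
  span of \<open>polar K\<close> is the orthogonal complement of \<open>lin_cone K\<close>, and a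
  relative interior point of \<open>polar K\<close> can be moved a little in every direction of that
  span. This turns an arbitrary vector orthogonal to \<open>{u. B u \<in> lin_cone K}\<close> into
  an admissible perturbation \<open>\<nu>\<close> of the multiplier. The projection step
  \<open>\<sigma>\<close> is fixed because a displacement of size o(t) then changes the normal by
  o(t) only; it is small because the curvature of \<open>G\<close> produces a term quadratic in
  \<open>d\<close> that has to be absorbed.\<close>

lemma polar_attains_infdist:
  fixes K :: "'e::euclidean_space set"
  assumes K: "closed K" "convex K" "cone K" "0 \<in> K"
  obtains \<mu> where "\<mu> \<in> polar K" "norm \<mu> \<le> 1" "\<mu> \<bullet> y = infdist y K"
proof -
  define c where "c = closest_point K y"
  define n where "n = y - c"
  have cK: "c \<in> K" unfolding c_def using K by (intro closest_point_in_set) auto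
  have le: "n \<bullet> (k - c) \<le> 0" if "k \<in> K" for k
    unfolding n_def c_def using closest_point_dot[OF K(2,1) that] .
  \<comment> \<open>Moreau decomposition: the variational inequality of the projection, tested at
    \<open>2 *\<^sub>R c\<close> and at 0, makes the residual \<open>n\<close> orthogonal to
    \<open>c\<close>. So \<open>n\<close> is polar to \<open>K\<close> and, once normalised, attains
    the distance.\<close>
  have "2 *\<^sub>R c \<in> K" using K(3) cK by (auto simp: cone_def)
  from le[OF this] le[OF K(4)] have nc: "n \<bullet> c = 0"
    by (simp add: inner_diff_right)
  have pol: "n \<in> polar K"
    using le nc by (auto simp: polar_def inner_diff_right)
  have "infdist y K = norm n"
    using setdist_closest_point[OF K(1), of y] K(4)
    by (auto simp: n_def c_def dist_norm infdist_eq_setdist)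
  moreover have "n \<bullet> y = norm n * norm n"
  proof -
    have "n \<bullet> n = n \<bullet> y" using nc by (simp add: n_def inner_diff_right)
    then show ?thesis by (simp add: power2_norm_eq_inner flip: power2_eq_square)
  qed
  ultimately show thesis
  proof (cases "n = 0")
    case True
    with that[of 0] \<open>infdist y K = norm n\<close> show thesis by (simp add: polar_def)
  next
    case False
    show thesis
    proof (rule that[of "n /\<^sub>R norm n"])
      show "n /\<^sub>R norm n \<in> polar K"
        using pol by (auto simp: polar_def mult_nonneg_nonpos)
      show "(n /\<^sub>R norm n) \<bullet> y = infdist y K"
        using False \<open>infdist y K = norm n\<close> \<open>n \<bullet> y = norm n * norm n\<close> by simp
    qed (use False in simp)
  qed
qed

text \<open>The bipolar theorem: the polar element that attains the distance pairs nonpositively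
  with \<open>y\<close>, so the distance vanishes.\<close>

lemma mem_if_polar_nonpos:
  fixes K :: "'e::euclidean_space set"
  assumes K: "closed K" "convex K" "cone K" "0 \<in> K"
    and y: "\<And>\<mu>. \<mu> \<in> polar K \<Longrightarrow> \<mu> \<bullet> y \<le> 0"
  shows "y \<in> K"
proof -
  obtain \<mu> where "\<mu> \<in> polar K" "\<mu> \<bullet> y = infdist y K"
    using polar_attains_infdist[OF K] by metis
  with y have "infdist y K = 0" by (metis antisym infdist_nonneg)
  with K show ?thesis by (metis empty_iff in_closed_iff_infdist_zero)
qed

lemma mem_lin_cone_iff: "y \<in> lin_cone K \<longleftrightarrow> y \<in> K \<and> - y \<in> K"
  by (auto simp: lin_cone_def) (metis add.inverse_inverse rev_image_eqI)

lemma convex_polar [simp]: "convex (polar K)"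
  unfolding convex_def polar_def
  by (auto simp: inner_add_left) (meson add_nonpos_nonpos mult_nonneg_nonpos)

lemma closed_polar [simp]: "closed (polar K)"
proof -
  have "polar K = (\<Inter>a\<in>K. {x. x \<bullet> a \<le> 0})" by (auto simp: polar_def)
  then show ?thesis
    by (simp add: closed_INT closed_Collect_le continuous_on_inner)
qed

lemma zero_in_polar [simp]: "0 \<in> polar K"
  by (simp add: polar_def)

lemma polar_add: "\<mu> \<in> polar K \<Longrightarrow> \<nu> \<in> polar K \<Longrightarrow> \<mu> + \<nu> \<in> polar K"
  by (auto simp: polar_def inner_add_left add_nonpos_nonpos)

lemma polar_scale: "\<mu> \<in> polar K \<Longrightarrow> 0 \<le> c \<Longrightarrow> c *\<^sub>R \<mu> \<in> polar K"
  by (auto simp: polar_def mult_nonneg_nonpos)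

lemma polar_lin_cone: "\<mu> \<in> polar K \<Longrightarrow> y \<in> lin_cone K \<Longrightarrow> \<mu> \<bullet> y = 0"
  by (auto simp: polar_def mem_lin_cone_iff intro!: antisym)

lemma lin_cone_subspace:
  assumes "convex K" "cone K" "0 \<in> K"
  shows "subspace (lin_cone K)"
proof (rule subspaceI)
  show "0 \<in> lin_cone K" using assms by (simp add: mem_lin_cone_iff)
next
  fix x y assume "x \<in> lin_cone K" "y \<in> lin_cone K"
  moreover have "a + b \<in> K" if "a \<in> K" "b \<in> K" for a b
    using assms that convex_cone by blast
  ultimately show "x + y \<in> lin_cone K"
    unfolding mem_lin_cone_iff minus_add_distrib by blast
next
  fix c :: real and x assume x: "x \<in> lin_cone K"
  then have "c *\<^sub>R x \<in> K" "c *\<^sub>R (- x) \<in> K" if "c \<ge> 0" for c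
    using assms that by (auto simp: mem_lin_cone_iff cone_def)
  from this[of c] this[of "-c"] show "c *\<^sub>R x \<in> lin_cone K"
    by (cases "c \<ge> 0") (auto simp: mem_lin_cone_iff)
qed

text \<open>A relative interior point is not an end point: the segment from \<open>\<nu>\<close> to
  \<open>\<mu>\<close> can be prolonged beyond \<open>\<mu>\<close>.\<close>

lemma polar_rel_interior_extend:
  assumes "\<mu> \<in> rel_interior (polar K)" "\<nu> \<in> polar K"
  obtains e where "e > 0" "\<mu> - e *\<^sub>R (\<nu> - \<mu>) \<in> polar K"
proof -
  have "\<exists>e>1. (1 - e) *\<^sub>R \<nu> + e *\<^sub>R \<mu> \<in> polar K"
    using convex_rel_interior_iff[OF convex_polar, of K \<mu>] assms by auto
  then obtain e where e: "e > 1" "(1 - e) *\<^sub>R \<nu> + e *\<^sub>R \<mu> \<in> polar K" by blast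
  show thesis
    by (rule that[of "e - 1"]) (use e in \<open>auto simp: algebra_simps\<close>)
qed

text \<open>Pairing with \<open>y\<close> is nonpositive on \<open>polar K\<close> and reaches its
  maximum 0 at a relative interior point, so it vanishes on all of \<open>polar K\<close>;
  bipolarity then puts \<open>- y\<close> into \<open>K\<close>.\<close>

lemma rel_interior_polar_critical:
  fixes K :: "'e::euclidean_space set"
  assumes K: "closed K" "convex K" "cone K" "0 \<in> K"
    and \<mu>: "\<mu> \<in> rel_interior (polar K)" and y: "y \<in> K" "\<mu> \<bullet> y = 0"
  shows "y \<in> lin_cone K"
proof -
  have "- y \<in> K"
  proof (rule mem_if_polar_nonpos[OF K])
    fix \<nu> assume "\<nu> \<in> polar K"
    then obtain e where e: "e > 0" "\<mu> - e *\<^sub>R (\<nu> - \<mu>) \<in> polar K"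
      by (rule polar_rel_interior_extend[OF \<mu>])
    then have "(\<mu> - e *\<^sub>R (\<nu> - \<mu>)) \<bullet> y \<le> 0" using y by (auto simp: polar_def)
    then have "e * (\<nu> \<bullet> y) \<ge> 0" using y by (simp add: inner_diff_left)
    with e show "\<nu> \<bullet> - y \<le> 0" by (simp add: zero_le_mult_iff)
  qed
  with y show ?thesis by (simp add: mem_lin_cone_iff)
qed

lemma orthogonal_preimage_lin_cone:
  fixes K :: "'e::euclidean_space set" and B :: "'x::euclidean_space \<Rightarrow> 'e"
  assumes K: "closed K" "convex K" "cone K" "0 \<in> K"
    and \<mu>: "\<mu> \<in> rel_interior (polar K)" and B: "linear B"
    and w: "\<And>u. B u \<in> lin_cone K \<Longrightarrow> w \<bullet> u = 0"
  obtains \<nu> e where "e > 0" "\<mu> + e *\<^sub>R \<nu> \<in> polar K" "\<And>u. w \<bullet> u = \<nu> \<bullet> B u"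
proof -
  have \<mu>p: "\<mu> \<in> polar K" using \<mu> rel_interior_subset by blast
  \<comment> \<open>The directions that stay in \<open>polar K\<close> for some positive step from
    \<open>\<mu>\<close>. Convexity gives closure under addition, the relative interior property
    closure under negation.\<close>
  define R where "R = {\<nu>. \<exists>e>0. \<mu> + e *\<^sub>R \<nu> \<in> polar K}"
  have mono: "\<mu> + f *\<^sub>R \<nu> \<in> polar K"
    if "\<mu> + e *\<^sub>R \<nu> \<in> polar K" "0 \<le> f" "f \<le> e" "e > 0" for e f \<nu>
  proof -
    have "(1 - f / e) *\<^sub>R \<mu> + (f / e) *\<^sub>R (\<mu> + e *\<^sub>R \<nu>) \<in> polar K"
      by (rule polar_add; rule polar_scale) (use that \<mu>p in \<open>auto simp: field_simps\<close>)
    then show ?thesis using that by (simp add: algebra_simps)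
  qed
  have neg: "- \<nu> \<in> R" if "\<nu> \<in> R" for \<nu>
  proof -
    from that obtain e where e: "e > 0" "\<mu> + e *\<^sub>R \<nu> \<in> polar K" by (auto simp: R_def)
    from polar_rel_interior_extend[OF \<mu> e(2)] obtain f
      where "f > 0" "\<mu> - f *\<^sub>R (\<mu> + e *\<^sub>R \<nu> - \<mu>) \<in> polar K" .
    with e show ?thesis unfolding R_def
      by (auto intro!: exI[of _ "f * e"])
  qed
  have scale: "c *\<^sub>R \<nu> \<in> R" if "\<nu> \<in> R" "c > 0" for c \<nu>
  proof -
    from that obtain e where "e > 0" "\<mu> + e *\<^sub>R \<nu> \<in> polar K" by (auto simp: R_def)
    with that show ?thesis unfolding R_def by (auto intro!: exI[of _ "e / c"])
  qed
  have "subspace R"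
  proof (rule subspaceI)
    show 0: "0 \<in> R" using \<mu>p by (auto simp: R_def intro: exI[of _ 1])
    fix c :: real and x assume "x \<in> R"
    then show "c *\<^sub>R x \<in> R"
      using scale[of x c] scale[of "- x" "- c"] neg[of x] 0 by (cases c "0::real" rule: linorder_cases) auto
  next
    fix x y assume "x \<in> R" "y \<in> R"
    then obtain e f where e: "e > 0" "\<mu> + e *\<^sub>R x \<in> polar K" and f: "f > 0" "\<mu> + f *\<^sub>R y \<in> polar K"
      by (auto simp: R_def)
    define d where "d = min e f"
    have "\<mu> + d *\<^sub>R x \<in> polar K" "\<mu> + d *\<^sub>R y \<in> polar K" "d > 0"
      using e f by (auto simp: d_def intro!: mono[OF e(2)] mono[OF f(2)])
    then have "(1/2) *\<^sub>R (\<mu> + d *\<^sub>R x) + (1/2) *\<^sub>R (\<mu> + d *\<^sub>R y) \<in> polar K"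
      by (intro polar_add[OF polar_scale polar_scale]) auto
    moreover have "(1/2) *\<^sub>R \<mu> + (1/2) *\<^sub>R \<mu> = \<mu>" by (simp flip: scaleR_add_left)
    then have "(1/2) *\<^sub>R (\<mu> + d *\<^sub>R x) + (1/2) *\<^sub>R (\<mu> + d *\<^sub>R y) = \<mu> + (d / 2) *\<^sub>R (x + y)"
      by (simp only: scaleR_add_right scaleR_scaleR) (simp add: add.assoc add.left_commute)
    ultimately have "\<mu> + (d / 2) *\<^sub>R (x + y) \<in> polar K" by simp
    with \<open>d > 0\<close> show "x + y \<in> R" unfolding R_def by (auto intro!: exI[of _ "d/2"])
  qed
  define S where "S = adjoint B ` R"
  have S: "subspace S" unfolding S_def
    using \<open>subspace R\<close> adjoint_linear[OF B] by (rule linear_subspace_image[rotated])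
  have adj: "adjoint B \<nu> \<bullet> u = \<nu> \<bullet> B u" for \<nu> u
    using adjoint_works[OF B, of u \<nu>] by (simp add: inner_commute)
  \<comment> \<open>The component \<open>z\<close> of \<open>w\<close> orthogonal to
    \<open>S\<close> satisfies \<open>\<nu> \<bullet> B z = 0\<close> for every polar
    \<open>\<nu>\<close>. By bipolarity \<open>B z\<close> lies in \<open>lin_cone K\<close>, and
    the hypothesis on \<open>w\<close> then kills \<open>z\<close>.\<close>
  obtain y z where y: "y \<in> span S" and z: "\<And>s. s \<in> span S \<Longrightarrow> orthogonal z s" and wyz: "w = y + z"
    using orthogonal_subspace_decomp_exists[of S w] by blast
  have z0: "\<nu> \<bullet> B z = 0" if "\<nu> \<in> R" for \<nu>
    using z[of "adjoint B \<nu>"] that adj[of \<nu> z]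
    by (simp add: S_def orthogonal_def span_base inner_commute)
  have "\<nu> \<in> R" if "\<nu> \<in> polar K" for \<nu>
    using that \<mu>p by (auto simp: R_def intro!: exI[of _ 1] polar_add)
  then have "B z \<in> K" "- B z \<in> K"
    using z0 by (auto intro!: mem_if_polar_nonpos[OF K])
  then have "w \<bullet> z = 0" using w by (simp add: mem_lin_cone_iff)
  moreover have "y \<bullet> z = 0" using z[OF y] by (simp add: orthogonal_def inner_commute)
  ultimately have "z = 0" by (simp add: wyz inner_add_left)
  then have "w \<in> S" using y wyz S by (metis add.right_neutral span_eq_iff)
  then obtain \<nu> where "\<nu> \<in> R" "w = adjoint B \<nu>" by (auto simp: S_def)
  then show thesis using that adj by (auto simp: R_def)
qed

section \<open>Tangent vectors and regular normals from quantitative estimates\<close>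

lemma tangent_coneI:
  assumes "\<And>\<epsilon>. \<epsilon> > 0 \<Longrightarrow> \<exists>t w'. 0 < t \<and> t < \<epsilon> \<and> norm (w' - w) \<le> \<epsilon> \<and> z + t *\<^sub>R w' \<in> \<Omega>"
  shows "w \<in> tangent_cone \<Omega> z"
proof -
  have "\<exists>t w'. 0 < t \<and> t < inverse (Suc k) \<and> norm (w' - w) \<le> inverse (Suc k) \<and> z + t *\<^sub>R w' \<in> \<Omega>" for k
    by (rule assms) simp
  then obtain t ws where *: "\<And>k. 0 < t k" "\<And>k. t k < inverse (Suc k)"
    "\<And>k. norm (ws k - w) \<le> inverse (Suc k)" "\<And>k. z + t k *\<^sub>R ws k \<in> \<Omega>"
    by metis
  have lim: "(\<lambda>k. inverse (real (Suc k))) \<longlonglongrightarrow> 0" by (rule LIMSEQ_inverse_real_of_nat)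
  have "t \<longlonglongrightarrow> 0"
    by (rule tendsto_sandwich[OF _ _ tendsto_const lim]) (use * in \<open>auto intro: less_imp_le eventuallyI\<close>)
  moreover have "(\<lambda>k. ws k - w) \<longlonglongrightarrow> 0"
    by (rule Lim_null_comparison[OF _ lim]) (use * in auto)
  then have "ws \<longlonglongrightarrow> w" by (simp add: LIM_zero_iff)
  ultimately show ?thesis using * by (auto simp: tangent_cone_def)
qed

text \<open>A proximal normal is a regular normal: squaring the comparison of distances leaves an
  error quadratic in the displacement, and after division by \<open>2 * \<sigma>\<close> it is below
  \<open>\<epsilon>\<close> times the norm on the radius
  \<open>2 * \<epsilon> * \<sigma>\<close>.\<close>

lemma regular_normal_nearest:
  assumes "x \<in> \<Omega>" "\<sigma> > 0" "r > 0"
    and near: "\<And>x'. x' \<in> \<Omega> \<Longrightarrow> dist x' x < r \<Longrightarrow> norm (y - x) \<le> norm (y - x')"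
  shows "(y - x) /\<^sub>R \<sigma> \<in> regular_normal \<Omega> x"
proof -
  have "\<exists>\<delta>>0. \<forall>z'\<in>\<Omega>. dist z' x < \<delta> \<longrightarrow> ((y - x) /\<^sub>R \<sigma>) \<bullet> (z' - x) \<le> \<epsilon> * norm (z' - x)"
    if "\<epsilon> > 0" for \<epsilon>
  proof (intro exI[of _ "min r (2 * \<epsilon> * \<sigma>)"] conjI ballI impI)
    show "0 < min r (2 * \<epsilon> * \<sigma>)" using assms that by simp
    fix z' assume z': "z' \<in> \<Omega>" "dist z' x < min r (2 * \<epsilon> * \<sigma>)"
    define d where "d = z' - x"
    have "norm (y - x) \<le> norm (y - x - d)"
      using near[OF z'(1)] z' by (simp add: d_def)
    then have "(norm (y - x))\<^sup>2 \<le> (norm (y - x - d))\<^sup>2" by simp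
    then have "2 * ((y - x) \<bullet> d) \<le> norm d * norm d"
      by (simp add: power2_norm_eq_inner inner_diff_left inner_diff_right inner_commute
          flip: power2_eq_square)
    also have "\<dots> \<le> (2 * \<epsilon> * \<sigma>) * norm d"
      using z' by (intro mult_right_mono) (auto simp: d_def dist_norm)
    finally show "((y - x) /\<^sub>R \<sigma>) \<bullet> (z' - x) \<le> \<epsilon> * norm (z' - x)"
      using assms(2) unfolding d_def[symmetric] inner_scaleR_left by (simp add: field_simps)
  qed
  with assms show ?thesis by (simp add: regular_normal_def)
qed

lemma regular_normalI:
  assumes "z \<in> \<Omega>" "\<And>z'. z' \<in> \<Omega> \<Longrightarrow> zs \<bullet> (z' - z) \<le> 0"
  shows "zs \<in> regular_normal \<Omega> z"
  using assms
  by (auto simp: regular_normal_def intro!: exI[of _ 1] order_trans[OF assms(2)])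

text \<open>Along a segment the quotient in the definition of a normal is constant, so the limsup
  bound becomes a plain inequality. This reads information off a normal cone without convexity of
  the set.\<close>

lemma regular_normal_ray:
  assumes n: "n \<in> regular_normal \<Omega> z"
    and ray: "\<And>\<tau>. 0 \<le> \<tau> \<Longrightarrow> \<tau> \<le> 1 \<Longrightarrow> z + \<tau> *\<^sub>R w \<in> \<Omega>"
  shows "n \<bullet> w \<le> 0"
proof (rule field_le_epsilon)
  fix e :: real assume e: "e > 0"
  define \<epsilon> where "\<epsilon> = e / (norm w + 1)"
  have \<epsilon>: "\<epsilon> > 0" using e by (simp add: \<epsilon>_def add_nonneg_pos)
  from n have "\<forall>\<epsilon>>0. \<exists>\<delta>>0. \<forall>z'\<in>\<Omega>. dist z' z < \<delta> \<longrightarrow> n \<bullet> (z' - z) \<le> \<epsilon> * norm (z' - z)"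
    by (auto simp: regular_normal_def split: if_splits)
  with \<epsilon> obtain \<delta> where \<delta>: "\<delta> > 0"
    "\<And>z'. z' \<in> \<Omega> \<Longrightarrow> dist z' z < \<delta> \<Longrightarrow> n \<bullet> (z' - z) \<le> \<epsilon> * norm (z' - z)" by blast
  define \<tau> where "\<tau> = min 1 (\<delta> / (norm w + 1) / 2)"
  have \<tau>: "0 < \<tau>" "\<tau> \<le> 1" using \<delta> by (auto simp: \<tau>_def add_nonneg_pos)
  have "\<tau> * norm w \<le> \<delta> / (norm w + 1) / 2 * norm w"
    by (intro mult_right_mono) (auto simp: \<tau>_def)
  also have "\<dots> < \<delta>" using \<delta>(1) 
  proof -
    have "0 \<le> norm w" by simp
    then have "norm w < (norm w + 1) * 2" by (simp add: algebra_simps add_nonneg_pos)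
    then have "norm w / (norm w + 1) / 2 < 1" by (simp add: divide_less_eq add_nonneg_pos)
    then have "\<delta> * (norm w / (norm w + 1) / 2) < \<delta> * 1" using \<delta>(1) by (intro mult_strict_left_mono)
    then show ?thesis by simp
  qed
  finally have "dist (z + \<tau> *\<^sub>R w) z < \<delta>" using \<tau> by (simp add: dist_norm)
  from \<delta>(2)[OF ray this] \<tau> have "\<tau> * (n \<bullet> w) \<le> \<tau> * (\<epsilon> * norm w)" by (simp add: algebra_simps)
  then have "n \<bullet> w \<le> \<epsilon> * norm w" using \<tau> by simp
  also have "\<dots> \<le> \<epsilon> * (norm w + 1)" using \<epsilon> by simp
  also have "\<dots> = e" by (simp add: \<epsilon>_def add_nonneg_eq_0_iff)
  finally show "n \<bullet> w \<le> 0 + e" by simp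
qed

section \<open>Multipliers and tangents of a Robinson stable system\<close>

text \<open>Frechet differentiability tolerates directions that vary with \<open>k\<close>, as those
  of tangent sequences do. It is applied both to the constraint map and to its derivative
  map.\<close>

lemma directional_quotient:
  fixes f :: "'a::real_normed_vector \<Rightarrow> 'b::real_normed_vector"
  assumes f: "(f has_derivative f') (at x)"
    and t: "\<And>k. t k > 0" "t \<longlonglongrightarrow> (0::real)" and w: "ws \<longlonglongrightarrow> w"
  shows "(\<lambda>k. (f (x + t k *\<^sub>R ws k) - f x) /\<^sub>R t k) \<longlonglongrightarrow> f' w"
proof -
  have lin: "bounded_linear f'" using f by (rule has_derivative_bounded_linear)
  have "(\<lambda>k. (f (x + t k *\<^sub>R ws k) - f x) /\<^sub>R t k - f' (ws k)) \<longlonglongrightarrow> 0"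
  proof (rule tendstoI)
    fix e :: real assume "e > 0"
    define e' where "e' = e / (norm w + 1)"
    have nw: "norm w + 1 > 0" by (simp add: add_nonneg_pos)
    then have e': "e' > 0" using \<open>e > 0\<close> by (simp add: e'_def)
    obtain d where d: "d > 0" "\<And>y. norm (y - x) < d \<Longrightarrow> norm (f y - f x - f' (y - x)) \<le> e' * norm (y - x)"
      using f e' unfolding has_derivative_at_alt by blast
    have "(\<lambda>k. t k *\<^sub>R ws k) \<longlonglongrightarrow> 0 *\<^sub>R w" by (intro tendsto_intros t w)
    then have "\<forall>\<^sub>F k in sequentially. norm (t k *\<^sub>R ws k) < d"
      using d(1) by (auto simp: tendsto_iff dist_norm)
    moreover have "\<forall>\<^sub>F k in sequentially. norm (ws k) < norm w + 1"
      using tendsto_norm[OF w] by (rule order_tendstoD) simp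
    ultimately show "\<forall>\<^sub>F k in sequentially. dist ((f (x + t k *\<^sub>R ws k) - f x) /\<^sub>R t k - f' (ws k)) 0 < e"
    proof eventually_elim
      case (elim k)
      define R where "R = f (x + t k *\<^sub>R ws k) - f x - f' (t k *\<^sub>R ws k)"
      have "norm R \<le> e' * norm (t k *\<^sub>R ws k)"
        using d(2)[of "x + t k *\<^sub>R ws k"] elim by (simp add: R_def)
      also have "\<dots> = t k * (e' * norm (ws k))" using t(1)[of k] by simp
      also have "\<dots> < t k * (e' * (norm w + 1))" using elim t(1)[of k] e' by simp
      also have "e' * (norm w + 1) = e" using nw by (simp add: e'_def)
      finally have "norm R < t k * e" .
      moreover have "(f (x + t k *\<^sub>R ws k) - f x) /\<^sub>R t k - f' (ws k) = R /\<^sub>R t k"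
        using t(1)[of k] by (simp add: R_def linear_simps[OF lin] scaleR_diff_right)
      ultimately show ?case using t(1)[of k] by (simp add: field_simps)
    qed
  qed
  from tendsto_add[OF this bounded_linear.tendsto[OF lin w]] show ?thesis by simp
qed

text \<open>\<open>RS\<close> carries a slack \<open>e\<close>, so that the distance to the slice
  need not be attained. Its witness may lie anywhere in \<open>\<Gamma> (fst z)\<close>; closeness
  is always deduced from the bound, while \<open>\<Gamma>_iff\<close> is available only inside the
  ball.\<close>

locale reduced_system =
  fixes G :: "'p::euclidean_space \<times> 'x::euclidean_space \<Rightarrow> 'e::euclidean_space"
    and DG :: "'p \<times> 'x \<Rightarrow> ('p \<times> 'x) \<Rightarrow>\<^sub>L 'e"
    and DDG :: "'p \<times> 'x \<Rightarrow> ('p \<times> 'x) \<Rightarrow>\<^sub>L 'e"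
    and K :: "'e set" and \<Gamma> :: "'p \<Rightarrow> 'x set" and zb :: "'p \<times> 'x" and \<rho> \<kappa> :: real
  assumes K: "closed K" "convex K" "cone K"
    and \<rho>: "\<rho> > 0" and \<kappa>: "\<kappa> \<ge> 0"
    and G0: "G zb = 0"
    and G_deriv: "z \<in> ball zb \<rho> \<Longrightarrow> (G has_derivative blinfun_apply (DG z)) (at z)"
    and DG_deriv: "(DG has_derivative DDG) (at zb)"
    and \<Gamma>_iff: "z \<in> ball zb \<rho> \<Longrightarrow> snd z \<in> \<Gamma> (fst z) \<longleftrightarrow> G z \<in> K"
    and RS: "z \<in> ball zb \<rho> \<Longrightarrow> e > 0 \<Longrightarrow>
               \<exists>x\<in>\<Gamma> (fst z). norm (x - snd z) \<le> \<kappa> * infdist (G z) K + e"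
    and zb_in: "snd zb \<in> \<Gamma> (fst zb)"
begin

abbreviation G' :: "'p \<times> 'x \<Rightarrow> 'p \<times> 'x \<Rightarrow> 'e" where
  "G' z \<equiv> blinfun_apply (DG z)"

abbreviation G'' :: "'p \<times> 'x \<Rightarrow> 'p \<times> 'x \<Rightarrow> 'e" where
  "G'' y \<equiv> blinfun_apply (DDG y)"

abbreviation \<Psi> :: "'p \<times> 'x \<Rightarrow> 'x set" where
  "\<Psi> \<equiv> \<lambda>(p, x). regular_normal (\<Gamma> p) x"

lemma zb_ball: "zb \<in> ball zb \<rho>" using \<rho> by simp

lemma K0: "0 \<in> K"
  using \<Gamma>_iff[OF zb_ball] zb_in G0 by simp

lemmas K4 = K K0

lemma infdist_le_norm: "k \<in> K \<Longrightarrow> infdist y K \<le> norm (y - k)"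
  using infdist_le[of k K y] by (simp add: dist_norm)

lemma deriv_near:
  assumes "z \<in> ball zb \<rho>" "\<epsilon> > 0"
  obtains \<delta> where "\<delta> > 0"
    "\<And>w. norm w < \<delta> \<Longrightarrow> norm (G (z + w) - G z - G' z w) \<le> \<epsilon> * norm w"
  using G_deriv[OF assms(1)] assms(2) unfolding has_derivative_at_alt
  by (metis add_diff_cancel_left')

text \<open>Robinson stability acts as an exact penalty: the shifted point
  \<open>x + \<tau> u\<close> is repaired at a cost of \<open>\<kappa>\<close> times its distance to
  feasibility, and the normal inequality at the repaired point bounds \<open>xs \<bullet> u\<close>
  by that cost. The polar element attaining the linearised distance is the approximate multiplier.
  It depends on \<open>u\<close>. Its nonnegative pairing with the shifted value becomes
  complementarity as \<open>\<tau>\<close> tends to 0.\<close>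

lemma multiplier_approx:
  assumes z: "z \<in> ball zb \<rho>" and xs: "xs \<in> \<Psi> z" and \<epsilon>: "\<epsilon> > 0"
  obtains \<tau> \<mu> where "0 < \<tau>" "\<tau> < \<epsilon>" "\<mu> \<in> polar K" "norm \<mu> \<le> 1"
    "\<mu> \<bullet> (G z + \<tau> *\<^sub>R G' z (0, u)) \<ge> 0"
    "xs \<bullet> u \<le> \<epsilon> + \<kappa> * norm xs * (\<mu> \<bullet> G' z (0, u))"
proof -
  obtain p x where zpx: "z = (p, x)" by force
  define b where "b = G' z (0, u)"
  have xs': "xs \<in> regular_normal (\<Gamma> p) x" using xs zpx by simp
  then have x: "x \<in> \<Gamma> p" by (auto simp: regular_normal_def split: if_splits)
  then have GzK: "G z \<in> K" using \<Gamma>_iff[OF z] zpx by simp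
  define M where "M = norm u + \<kappa> * (norm b + 1) + 1 + norm xs * (\<kappa> + 1)"
  have M: "M \<ge> 1" using \<kappa> by (simp add: M_def)
  define \<eta> where "\<eta> = min 1 (\<epsilon> / M)"
  have \<eta>: "0 < \<eta>" "\<eta> \<le> 1" "\<eta> * M \<le> \<epsilon>"
    using \<epsilon> M by (auto simp: \<eta>_def min_def field_simps)
  obtain \<delta>1 where \<delta>1: "\<delta>1 > 0"
    "\<And>x'. x' \<in> \<Gamma> p \<Longrightarrow> dist x' x < \<delta>1 \<Longrightarrow> xs \<bullet> (x' - x) \<le> \<eta> * norm (x' - x)"
    using xs' \<eta>(1) by (auto simp: regular_normal_def split: if_splits)
  define \<epsilon>2 where "\<epsilon>2 = \<eta> / (norm u + 1)"
  have \<epsilon>2: "\<epsilon>2 > 0" "\<epsilon>2 * norm u \<le> \<eta>"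
    using \<eta> by (auto simp: \<epsilon>2_def add_nonneg_pos divide_le_eq mult_left_mono)
  obtain \<delta>2 where \<delta>2: "\<delta>2 > 0"
    "\<And>w. norm w < \<delta>2 \<Longrightarrow> norm (G (z + w) - G z - G' z w) \<le> \<epsilon>2 * norm w"
    using deriv_near[OF z \<epsilon>2(1)] by blast
  obtain \<delta>3 where \<delta>3: "\<delta>3 > 0" "ball z \<delta>3 \<subseteq> ball zb \<rho>"
    using z open_ball open_contains_ball by blast
  \<comment> \<open>\<open>Q\<close> bounds \<open>norm (x' - x)\<close> per unit of
    \<open>\<tau>\<close>: the step \<open>u\<close>, the repair, and the slack in
    \<open>RS\<close>. The constant \<open>M\<close> above is \<open>Q\<close> plus
    \<open>norm xs * (\<kappa> + 1)\<close>, the total factor of \<open>\<eta>\<close> in the final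
    estimate.\<close>
  define Q where "Q = norm u + \<kappa> * (norm b + 1) + 1"
  have Q: "Q \<ge> 1" "norm u < Q" using \<kappa> by (auto simp: Q_def add_nonneg_pos)
  define \<tau> where "\<tau> = min (min \<epsilon> \<eta>) (min (\<delta>1/Q) (min (\<delta>2/Q) (\<delta>3/Q))) / 2"
  have \<tau>0: "\<tau> > 0" using \<epsilon> \<eta> \<delta>1 \<delta>2 \<delta>3 Q by (simp add: \<tau>_def)
  have "\<tau> < min (min \<epsilon> \<eta>) (min (\<delta>1/Q) (min (\<delta>2/Q) (\<delta>3/Q)))"
    using \<tau>0 unfolding \<tau>_def by linarith
  then have \<tau>: "\<tau> < \<epsilon>" "\<tau> < \<eta>" "\<tau> * Q < \<delta>1" "\<tau> * Q < \<delta>2" "\<tau> * Q < \<delta>3"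
    using Q by (auto simp: field_simps)
  define w where "w = \<tau> *\<^sub>R (0::'p, u)"
  have nw: "norm w = \<tau> * norm u" using \<tau>0 by (simp add: w_def)
  have "norm w \<le> \<tau> * Q" using \<tau>0 Q nw by simp
  then have w: "norm w < \<delta>2" "z + w \<in> ball zb \<rho>"
    using \<tau> \<delta>3 by (auto simp: subset_eq dist_norm)
  have G'w: "G' z w = \<tau> *\<^sub>R b" unfolding w_def b_def by (rule blinfun.scaleR_right)
  have "norm (G (z + w) - (G z + \<tau> *\<^sub>R b)) \<le> \<tau> * (\<epsilon>2 * norm u)"
    using \<delta>2(2)[OF w(1)] nw G'w by (simp add: algebra_simps)
  also have "\<dots> \<le> \<tau> * \<eta>" using \<tau>0 \<epsilon>2 by simp
  finally have Gw: "norm (G (z + w) - (G z + \<tau> *\<^sub>R b)) \<le> \<tau> * \<eta>" .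
  obtain \<mu> where \<mu>: "\<mu> \<in> polar K" "norm \<mu> \<le> 1" "\<mu> \<bullet> (G z + \<tau> *\<^sub>R b) = infdist (G z + \<tau> *\<^sub>R b) K"
    using polar_attains_infdist[OF K4] .
  have \<mu>G: "\<mu> \<bullet> G z \<le> 0" using \<mu> GzK by (simp add: polar_def)
  define D where "D = infdist (G (z + w)) K"
  have D0: "D \<ge> 0" by (simp add: D_def infdist_nonneg)
  have "D \<le> infdist (G z + \<tau> *\<^sub>R b) K + \<tau> * \<eta>"
    unfolding D_def using infdist_triangle[of "G (z + w)" K "G z + \<tau> *\<^sub>R b"] Gw
    by (simp add: dist_norm)
  \<comment> \<open>As \<open>G z\<close> lies in \<open>K\<close>, its pairing with
    \<open>\<mu>\<close> is nonpositive and only the directional part of the distance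
    remains.\<close>
  then have D1: "D \<le> \<tau> * (\<mu> \<bullet> b) + \<tau> * \<eta>"
    using \<mu>(3) \<mu>G by (simp add: inner_add_right)
  have "\<mu> \<bullet> b \<le> norm b" using norm_cauchy_schwarz[of \<mu> b] mult_right_mono[OF \<mu>(2), of "norm b"] by simp
  then have D2: "D \<le> \<tau> * (norm b + 1)"
    using D1 \<tau>0 \<eta>(2) by (smt (verit) distrib_left mult_left_mono)
  have "\<tau> * \<eta> > 0" using \<tau>0 \<eta> by simp
  from RS[OF w(2) this] obtain x' where x': "x' \<in> \<Gamma> p" "norm (x' - (x + \<tau> *\<^sub>R u)) \<le> \<kappa> * D + \<tau> * \<eta>"
    by (auto simp: D_def w_def zpx)
  have "norm (x' - x) \<le> norm (x' - (x + \<tau> *\<^sub>R u)) + norm (\<tau> *\<^sub>R u)"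
    using norm_triangle_ineq[of "x' - (x + \<tau> *\<^sub>R u)" "\<tau> *\<^sub>R u"] by (simp add: algebra_simps)
  also have "\<dots> \<le> \<kappa> * (\<tau> * (norm b + 1)) + \<tau> * 1 + \<tau> * norm u"
  proof -
    have "\<tau> * \<eta> \<le> \<tau> * 1" using \<eta>(2) \<tau>0 by simp
    moreover have "norm (\<tau> *\<^sub>R u) = \<tau> * norm u" using \<tau>0 by simp
    ultimately show ?thesis using x'(2) mult_left_mono[OF D2 \<kappa>] by linarith
  qed
  also have "\<dots> = \<tau> * Q" by (simp add: Q_def algebra_simps)
  finally have nx': "norm (x' - x) \<le> \<tau> * Q" .
  have "xs \<bullet> (x' - x) \<le> \<eta> * norm (x' - x)"
    using \<delta>1(2)[OF x'(1)] nx' \<tau> by (simp add: dist_norm)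
  also have "\<dots> \<le> \<eta> * (\<tau> * Q)" using nx' \<eta> by simp
  finally have 1: "xs \<bullet> (x' - x) \<le> \<tau> * (\<eta> * Q)" by (simp add: algebra_simps)
  have "xs \<bullet> ((x + \<tau> *\<^sub>R u) - x') \<le> norm xs * norm ((x + \<tau> *\<^sub>R u) - x')" by (rule norm_cauchy_schwarz)
  also have "\<dots> \<le> norm xs * (\<kappa> * (\<tau> * (\<mu> \<bullet> b) + \<tau> * \<eta>) + \<tau> * \<eta>)"
    using x'(2) mult_left_mono[OF D1 \<kappa>] by (intro mult_left_mono) (auto simp: norm_minus_commute)
  finally have 2: "xs \<bullet> ((x + \<tau> *\<^sub>R u) - x') \<le> \<tau> * (norm xs * (\<kappa> * (\<mu> \<bullet> b) + \<kappa> * \<eta> + \<eta>))"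
    by (simp add: algebra_simps)
  have "\<tau> * (xs \<bullet> u) = xs \<bullet> (x' - x) + xs \<bullet> ((x + \<tau> *\<^sub>R u) - x')"
    by (simp add: inner_diff_right inner_add_right)
  also have "\<dots> \<le> \<tau> * (\<eta> * Q) + \<tau> * (norm xs * (\<kappa> * (\<mu> \<bullet> b) + \<kappa> * \<eta> + \<eta>))" using 1 2 by linarith
  also have "\<dots> = \<tau> * (\<eta> * M + \<kappa> * norm xs * (\<mu> \<bullet> b))"
    by (simp add: M_def Q_def algebra_simps)
  finally have "xs \<bullet> u \<le> \<eta> * M + \<kappa> * norm xs * (\<mu> \<bullet> b)" using \<tau>0 by simp
  then have "xs \<bullet> u \<le> \<epsilon> + \<kappa> * norm xs * (\<mu> \<bullet> b)" using \<eta>(3) by simp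
  moreover have "\<mu> \<bullet> (G z + \<tau> *\<^sub>R b) \<ge> 0" using \<mu>(3) by (simp add: infdist_nonneg)
  ultimately show thesis
    using that[OF \<tau>0 \<tau>(1) \<mu>(1,2)] by (simp add: b_def)
qed

text \<open>The approximate multipliers depend on the direction, so a single one is found by
  separation: a direction \<open>u\<close> separating \<open>xs\<close> from the image of all
  admissible multipliers is refuted by a limit of approximate multipliers for this very
  \<open>u\<close>, scaled by \<open>\<kappa> * norm xs\<close>.\<close>

lemma multiplier:
  assumes z: "z \<in> ball zb \<rho>" and xs: "xs \<in> \<Psi> z"
  obtains \<mu> where "\<mu> \<in> polar K" "norm \<mu> \<le> \<kappa> * norm xs" "\<mu> \<bullet> G z = 0"
    "\<And>u. xs \<bullet> u = \<mu> \<bullet> G' z (0, u)"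
proof -
  define B where "B u = G' z (0, u)" for u
  have B: "linear B"
    unfolding B_def
    by (rule linearI) (auto simp: blinfun.add_right[symmetric] blinfun.scaleR_right[symmetric])
  have adj: "adjoint B \<nu> \<bullet> u = \<nu> \<bullet> B u" for \<nu> u
    using adjoint_works[OF B, of u \<nu>] by (simp add: inner_commute)
  define r where "r = \<kappa> * norm xs"
  have r: "r \<ge> 0" using \<kappa> by (simp add: r_def)
  have "G z \<in> K"
    using xs \<Gamma>_iff[OF z] by (auto simp: regular_normal_def split: if_splits prod.splits)
  \<comment> \<open>The norm bound makes \<open>N\<close> compact, hence its image under the adjoint
    closed, as strict separation demands.\<close>
  define N where "N = polar K \<inter> cball 0 r \<inter> {\<mu>. \<mu> \<bullet> G z = 0}"
  have N: "convex N" "compact N"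
    unfolding N_def
     apply (intro convex_Int convex_polar convex_cball)
     apply (simp add: convex_def inner_add_left)
    apply (rule compact_Int_closed[OF closed_Int_compact[OF closed_polar compact_cball]])
    apply (intro closed_Collect_eq continuous_intros)
    done
  have S: "convex (adjoint B ` N)" "closed (adjoint B ` N)"
    using adjoint_linear[OF B] N
    by (auto intro!: convex_linear_image compact_imp_closed compact_continuous_image linear_continuous_on
        simp: linear_conv_bounded_linear)
  have "xs \<in> adjoint B ` N"
  proof (rule ccontr)
    assume "xs \<notin> adjoint B ` N"
    from separating_hyperplane_closed_point[OF S this] obtain a c
      where a: "a \<bullet> xs < c" "\<And>s. s \<in> adjoint B ` N \<Longrightarrow> c < a \<bullet> s" by blast
    define u where "u = - a"
    have xsu: "xs \<bullet> u > - c" and Nu: "\<mu> \<bullet> B u < - c" if "\<mu> \<in> N" for \<mu>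
    proof -
      show "xs \<bullet> u > - c" using a(1) by (simp add: u_def inner_commute)
      show "\<mu> \<bullet> B u < - c" using a(2)[of "adjoint B \<mu>"] that adj[of \<mu> u]
        by (simp add: u_def inner_commute)
    qed
    have "\<exists>\<tau> \<mu>. 0 < \<tau> \<and> \<tau> < inverse (Suc k) \<and> \<mu> \<in> polar K \<and> norm \<mu> \<le> 1 \<and>
        \<mu> \<bullet> (G z + \<tau> *\<^sub>R B u) \<ge> 0 \<and> xs \<bullet> u \<le> inverse (Suc k) + r * (\<mu> \<bullet> B u)" for k
    proof -
      have "inverse (real (Suc k)) > 0" by simp
      from multiplier_approx[OF z xs this, of u] show ?thesis unfolding r_def B_def by blast
    qed
    then obtain \<tau> \<mu> where *: "\<And>k. 0 < \<tau> k" "\<And>k. \<tau> k < inverse (Suc k)" "\<And>k. \<mu> k \<in> polar K \<inter> cball 0 1"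
      "\<And>k. \<mu> k \<bullet> (G z + \<tau> k *\<^sub>R B u) \<ge> 0" "\<And>k. xs \<bullet> u \<le> inverse (Suc k) + r * (\<mu> k \<bullet> B u)"
      by simp metis
    have "compact (polar K \<inter> cball 0 1)" by (intro closed_Int_compact) auto
    then obtain l s where l: "l \<in> polar K \<inter> cball 0 1" "strict_mono s" "(\<mu> \<circ> s) \<longlonglongrightarrow> l"
      using *(3) unfolding compact_def by meson
    have lim0: "(\<lambda>k. inverse (real (Suc k))) \<longlonglongrightarrow> 0" by (rule LIMSEQ_inverse_real_of_nat)
    have "\<tau> \<longlonglongrightarrow> 0"
      by (rule tendsto_sandwich[OF _ _ tendsto_const lim0]) (use * in \<open>auto intro: less_imp_le eventuallyI\<close>)
    then have \<tau>s: "(\<tau> \<circ> s) \<longlonglongrightarrow> 0" and lims: "((\<lambda>k. inverse (real (Suc k))) \<circ> s) \<longlonglongrightarrow> 0"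
      using l(2) lim0 LIMSEQ_subseq_LIMSEQ by blast+
    have "(\<lambda>k. (\<mu> \<circ> s) k \<bullet> (G z + (\<tau> \<circ> s) k *\<^sub>R B u)) \<longlonglongrightarrow> l \<bullet> (G z + 0 *\<^sub>R B u)"
      by (intro tendsto_intros l(3) \<tau>s)
    then have "l \<bullet> (G z + 0 *\<^sub>R B u) \<ge> 0"
      by (rule LIMSEQ_le_const) (use *(4) in auto)
    moreover have "l \<bullet> G z \<le> 0" using l(1) \<open>G z \<in> K\<close> by (simp add: polar_def)
    ultimately have lG: "l \<bullet> G z = 0" by simp
    have "(\<lambda>k. ((\<lambda>k. inverse (real (Suc k))) \<circ> s) k + r * ((\<mu> \<circ> s) k \<bullet> B u)) \<longlonglongrightarrow> 0 + r * (l \<bullet> B u)"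
      by (intro tendsto_intros l(3) lims)
    then have "0 + r * (l \<bullet> B u) \<ge> xs \<bullet> u"
      by (rule LIMSEQ_le_const) (use *(5) in auto)
    then have le: "xs \<bullet> u \<le> (r *\<^sub>R l) \<bullet> B u" by simp
    have "norm (r *\<^sub>R l) \<le> r" using l(1) r by (simp add: mult_left_le)
    then have "r *\<^sub>R l \<in> N" using l(1) r lG by (auto simp: N_def intro: polar_scale)
    with le xsu Nu show False by force
  qed
  then obtain \<mu> where "\<mu> \<in> N" "xs = adjoint B \<mu>" by blast
  with that adj show thesis by (auto simp: N_def r_def B_def)
qed

lemma tangent_imp:
  assumes "w \<in> tangent_cone (gph \<Gamma>) zb"
  shows "G' zb w \<in> K"
proof -
  obtain t ws where *: "\<And>k. t k > 0" "t \<longlonglongrightarrow> 0" "ws \<longlonglongrightarrow> w" "\<And>k. zb + t k *\<^sub>R ws k \<in> gph \<Gamma>"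
    using assms unfolding tangent_cone_def by blast
  have lim: "(\<lambda>k. (G (zb + t k *\<^sub>R ws k) - G zb) /\<^sub>R t k) \<longlonglongrightarrow> G' zb w"
    by (rule directional_quotient[OF G_deriv[OF zb_ball] *(1-3)])
  have "(\<lambda>k. zb + t k *\<^sub>R ws k) \<longlonglongrightarrow> zb + 0 *\<^sub>R w" by (intro tendsto_intros *)
  then have "\<forall>\<^sub>F k in sequentially. zb + t k *\<^sub>R ws k \<in> ball zb \<rho>"
    using \<rho> by (auto simp: tendsto_iff dist_commute)
  then have "\<forall>\<^sub>F k in sequentially. (G (zb + t k *\<^sub>R ws k) - G zb) /\<^sub>R t k \<in> K"
  proof eventually_elim
    case (elim k)
    then have "G (zb + t k *\<^sub>R ws k) \<in> K"
      using \<Gamma>_iff[OF elim] *(4)[of k] by (auto simp: gph_def split_beta)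
    then show ?case using K(3) *(1)[of k] G0 by (simp add: cone_def)
  qed
  then show ?thesis
    using Lim_in_closed_set[OF K(1) _ _ lim] by simp
qed

text \<open>If \<open>G' zb w\<close> is in \<open>K\<close>, the straight point
  \<open>zb + t w\<close> violates the constraint by o(t) only, and Robinson stability repairs it by
  moving \<open>x\<close> alone, again by o(t).\<close>

lemma tangentI:
  assumes w: "G' zb w \<in> K"
  shows "w \<in> tangent_cone (gph \<Gamma>) zb"
proof (rule tangent_coneI)
  fix \<epsilon> :: real assume \<epsilon>: "\<epsilon> > 0"
  \<comment> \<open>The repair has size at most
    \<open>t * (\<kappa> * \<eta> * norm w + \<eta>)\<close>, which equals
    \<open>t * \<epsilon>\<close> for \<open>\<eta> = \<epsilon> / c\<close>.\<close>
  define c where "c = \<kappa> * norm w + 1"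
  have c: "c \<ge> 1" using \<kappa> by (simp add: c_def)
  define \<eta> where "\<eta> = \<epsilon> / c"
  have \<eta>: "\<eta> > 0" using \<epsilon> c by (simp add: \<eta>_def)
  obtain \<delta> where \<delta>: "\<delta> > 0"
    "\<And>w. norm w < \<delta> \<Longrightarrow> norm (G (zb + w) - G zb - G' zb w) \<le> \<eta> * norm w"
    using deriv_near[OF zb_ball \<eta>] by blast
  define t where "t = min \<epsilon> (min \<delta> \<rho> / (norm w + 1)) / 2"
  have nw: "norm w + 1 > 0" by (simp add: add_nonneg_pos)
  have t0: "t > 0" using \<epsilon> \<delta>(1) \<rho> nw by (simp add: t_def)
  have "t < min \<epsilon> (min \<delta> \<rho> / (norm w + 1))" using t0 unfolding t_def by linarith
  then have t: "t < \<epsilon>" "t * (norm w + 1) < \<delta>" "t * (norm w + 1) < \<rho>"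
    using nw by (auto simp: field_simps)
  have "norm (t *\<^sub>R w) \<le> t * (norm w + 1)" using t0 by simp
  then have tw: "norm (t *\<^sub>R w) < \<delta>" "zb + t *\<^sub>R w \<in> ball zb \<rho>"
    using t by (auto simp: dist_norm)
  have "t *\<^sub>R G' zb w \<in> K" using w K(3) t0 by (simp add: cone_def)
  then have "infdist (G (zb + t *\<^sub>R w)) K \<le> norm (G (zb + t *\<^sub>R w) - t *\<^sub>R G' zb w)"
    by (rule infdist_le_norm)
  also have "\<dots> \<le> \<eta> * norm (t *\<^sub>R w)" using \<delta>(2)[OF tw(1)] by (simp add: G0 blinfun.scaleR_right)
  also have "\<dots> = t * (\<eta> * norm w)" using t0 by simp
  finally have inf: "infdist (G (zb + t *\<^sub>R w)) K \<le> t * (\<eta> * norm w)" .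
  have "t * \<eta> > 0" using t0 \<eta> by simp
  from RS[OF tw(2) this] obtain x' where x': "x' \<in> \<Gamma> (fst zb + t *\<^sub>R fst w)"
    "norm (x' - (snd zb + t *\<^sub>R snd w)) \<le> \<kappa> * infdist (G (zb + t *\<^sub>R w)) K + t * \<eta>"
    by auto
  have x'2: "norm (x' - (snd zb + t *\<^sub>R snd w)) \<le> t * \<epsilon>"
  proof -
    have "\<kappa> * infdist (G (zb + t *\<^sub>R w)) K + t * \<eta> \<le> \<kappa> * (t * (\<eta> * norm w)) + t * \<eta>"
      using mult_left_mono[OF inf \<kappa>] by simp
    also have "\<dots> = t * (\<eta> * c)" by (simp add: c_def algebra_simps)
    also have "\<eta> * c = \<epsilon>" using c by (simp add: \<eta>_def)
    finally show ?thesis using x'(2) by simp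
  qed
  define w' where "w' = (fst w, (x' - snd zb) /\<^sub>R t)"
  define d where "d = x' - (snd zb + t *\<^sub>R snd w)"
  have "w' - w = (0, d /\<^sub>R t)"
    using t0 by (simp add: w'_def d_def prod_eq_iff scaleR_diff_right scaleR_add_right)
  then have "norm (w' - w) = norm d / t" using t0 by (simp add: field_simps)
  then have "norm (w' - w) \<le> \<epsilon>" using x'2 t0 by (simp add: d_def divide_le_eq mult.commute)
  moreover have "zb + t *\<^sub>R w' \<in> gph \<Gamma>"
    using x' t0 by (cases zb) (simp add: w'_def gph_def)
  ultimately show "\<exists>t w'. 0 < t \<and> t < \<epsilon> \<and> norm (w' - w) \<le> \<epsilon> \<and> zb + t *\<^sub>R w' \<in> gph \<Gamma>"
    using t0 t by blast
qed

lemma tangent_iff: "w \<in> tangent_cone (gph \<Gamma>) zb \<longleftrightarrow> G' zb w \<in> K"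
  using tangent_imp tangentI by blast

end

section \<open>Limits of multiplier difference quotients\<close>

lemma eventually_scaled_less:
  fixes C D :: real
  assumes "D > 0"
  shows "\<forall>\<^sub>F t in at_right 0. t * C < D"
proof -
  have "((\<lambda>t. t * C) \<longlongrightarrow> 0 * C) (at_right 0)" by (intro tendsto_intros)
  then show ?thesis using order_tendstoD(2)[of _ _ _ D] assms by simp
qed

context reduced_system
begin

lemma graphical_derivative_multiplier:
  assumes vs: "vs \<in> graphical_derivative \<Psi> zb xs v"
  obtains \<mu> where "\<mu> \<in> polar K" "\<And>u. xs \<bullet> u = \<mu> \<bullet> G' zb (0, u)"
    "G' zb v \<in> K" "\<mu> \<bullet> G' zb v = 0"
    "\<And>u. G' zb (0, u) \<in> lin_cone K \<Longrightarrow> vs \<bullet> u = \<mu> \<bullet> G'' v (0, u)"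
proof -
  obtain t ws where t: "\<And>k. t k > 0" "t \<longlonglongrightarrow> 0" and ws: "ws \<longlonglongrightarrow> (v, vs)"
    and mem: "\<And>k. (zb, xs) + t k *\<^sub>R ws k \<in> gph \<Psi>"
    using vs unfolding graphical_derivative_def tangent_cone_def by blast
  define w y where "w k = fst (ws k)" and "y k = snd (ws k)" for k
  define z where "z k = zb + t k *\<^sub>R w k" for k
  have w: "w \<longlonglongrightarrow> v" and y: "y \<longlonglongrightarrow> vs"
    using tendsto_fst[OF ws] tendsto_snd[OF ws] by (simp_all add: w_def[abs_def] y_def[abs_def])
  have nrm: "xs + t k *\<^sub>R y k \<in> \<Psi> (z k)" for k
    using mem[of k] by (auto simp: gph_def z_def w_def y_def split_beta)
  have z\<Gamma>: "z k \<in> gph \<Gamma>" for k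
    using nrm[of k] by (auto simp: gph_def regular_normal_def split_beta split: if_splits)
  then have "v \<in> tangent_cone (gph \<Gamma>) zb"
    unfolding tangent_cone_def z_def using t w by blast
  then have vK: "G' zb v \<in> K" by (rule tangent_imp)
  have "z \<longlonglongrightarrow> zb + 0 *\<^sub>R v"
    unfolding z_def[abs_def] by (intro tendsto_intros t w)
  then have z_lim: "z \<longlonglongrightarrow> zb" by simp
  then have ball: "\<forall>\<^sub>F k in sequentially. z k \<in> ball zb \<rho>"
    using \<rho> by (auto simp: tendsto_iff dist_commute)
  have "\<exists>\<mu>. \<mu> \<in> polar K \<and> norm \<mu> \<le> \<kappa> * norm (xs + t k *\<^sub>R y k) \<and>
      (z k \<in> ball zb \<rho> \<longrightarrow> \<mu> \<bullet> G (z k) = 0 \<and> (\<forall>u. (xs + t k *\<^sub>R y k) \<bullet> u = \<mu> \<bullet> G' (z k) (0, u)))" for k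
  proof (cases "z k \<in> ball zb \<rho>")
    case True
    from multiplier[OF True nrm] show ?thesis by blast
  next
    case False
    \<comment> \<open>Outside the ball 0 is a default value; it keeps polarity and the norm bound
      valid for every index.\<close>
    then show ?thesis using \<kappa> by (intro exI[of _ 0]) auto
  qed
  then obtain m where m: "\<And>k. m k \<in> polar K" "\<And>k. norm (m k) \<le> \<kappa> * norm (xs + t k *\<^sub>R y k)"
    "\<And>k. z k \<in> ball zb \<rho> \<Longrightarrow> m k \<bullet> G (z k) = 0"
    "\<And>k u. z k \<in> ball zb \<rho> \<Longrightarrow> (xs + t k *\<^sub>R y k) \<bullet> u = m k \<bullet> G' (z k) (0, u)"
    by metis
  have xlim: "(\<lambda>k. xs + t k *\<^sub>R y k) \<longlonglongrightarrow> xs + 0 *\<^sub>R vs" by (intro tendsto_intros t y)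
  then have "Bseq (\<lambda>k. xs + t k *\<^sub>R y k)" by (intro convergent_imp_Bseq convergentI)
  then obtain b where b: "\<And>k. norm (xs + t k *\<^sub>R y k) \<le> b" by (auto simp: Bseq_def)
  have "norm (m k) \<le> \<kappa> * b" for k
    using m(2)[of k] mult_left_mono[OF b[of k] \<kappa>] by linarith
  then have "bounded (range m)" by (auto simp: bounded_iff)
  then obtain \<mu> s where s: "strict_mono s" and \<mu>: "(m \<circ> s) \<longlonglongrightarrow> \<mu>"
    using bounded_imp_convergent_subsequence by blast
  have \<mu>': "(\<lambda>k. m (s k)) \<longlonglongrightarrow> \<mu>" using \<mu> by (simp add: o_def)
  have sub: "(\<lambda>k. f (s k)) \<longlonglongrightarrow> l" if "f \<longlonglongrightarrow> l" for f :: "nat \<Rightarrow> 'z::topological_space" and l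
    using LIMSEQ_subseq_LIMSEQ[OF that s] by (simp add: o_def)
  have sball: "\<forall>\<^sub>F k in sequentially. z (s k) \<in> ball zb \<rho>"
    using eventually_subseq[OF s ball] .
  have \<mu>K: "\<mu> \<in> polar K"
    by (rule Lim_in_closed_set[OF closed_polar _ _ \<mu>']) (use m(1) in auto)
  have DG_lim: "(\<lambda>k. DG (z k)) \<longlonglongrightarrow> DG zb"
    using has_derivative_continuous[OF DG_deriv] z_lim
    by (auto simp: continuous_at_sequentially o_def)
  have xsu: "xs \<bullet> u = \<mu> \<bullet> G' zb (0, u)" for u
  proof -
    have "(\<lambda>k. m (s k) \<bullet> G' (z (s k)) (0, u)) \<longlonglongrightarrow> \<mu> \<bullet> G' zb (0, u)"
      by (intro tendsto_intros \<mu>' sub[OF DG_lim])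
    moreover have "(\<lambda>k. m (s k) \<bullet> G' (z (s k)) (0, u)) \<longlonglongrightarrow> (xs + 0 *\<^sub>R vs) \<bullet> u"
    proof (rule Lim_transform_eventually)
      show "(\<lambda>k. (xs + t (s k) *\<^sub>R y (s k)) \<bullet> u) \<longlonglongrightarrow> (xs + 0 *\<^sub>R vs) \<bullet> u"
        by (intro tendsto_intros sub[OF t(2)] sub[OF y])
      show "\<forall>\<^sub>F k in sequentially. (xs + t (s k) *\<^sub>R y (s k)) \<bullet> u = m (s k) \<bullet> G' (z (s k)) (0, u)"
        using sball by eventually_elim (rule m(4))
    qed
    ultimately show ?thesis using LIMSEQ_unique by fastforce
  qed
  \<comment> \<open>Complementarity along the sequence is divided by \<open>t k\<close>; because
    \<open>G zb = 0\<close>, the difference quotient of \<open>G\<close> appears.\<close>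
  have \<mu>v: "\<mu> \<bullet> G' zb v = 0"
  proof -
    have "(\<lambda>k. (G (z k) - G zb) /\<^sub>R t k) \<longlonglongrightarrow> G' zb v"
      unfolding z_def by (rule directional_quotient[OF G_deriv[OF zb_ball] t w])
    then have "(\<lambda>k. m (s k) \<bullet> ((G (z (s k)) - G zb) /\<^sub>R t (s k))) \<longlonglongrightarrow> \<mu> \<bullet> G' zb v"
      by (intro tendsto_inner \<mu>') (rule sub)
    moreover have "(\<lambda>k. m (s k) \<bullet> ((G (z (s k)) - G zb) /\<^sub>R t (s k))) \<longlonglongrightarrow> 0"
      by (rule tendsto_eventually) (use sball in eventually_elim, simp add: G0 m(3))
    ultimately show ?thesis using LIMSEQ_unique by blast
  qed
  have vsu: "vs \<bullet> u = \<mu> \<bullet> G'' v (0, u)" if u: "G' zb (0, u) \<in> lin_cone K" for u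
  proof -
    \<comment> \<open>Every \<open>m k\<close>, not just the limit, annihilates
      \<open>lin_cone K\<close>. Hence \<open>m k \<bullet> G' zb (0, u)\<close> can be subtracted
      at no cost, which creates the difference quotient of \<open>DG\<close>.\<close>
    have zero: "m k \<bullet> G' zb (0, u) = 0" for k using polar_lin_cone[OF m(1) u] .
    have xs0: "xs \<bullet> u = 0" using polar_lin_cone[OF \<mu>K u] xsu by simp
    have "(\<lambda>k. (DG (z k) - DG zb) /\<^sub>R t k) \<longlonglongrightarrow> DDG v"
      unfolding z_def by (rule directional_quotient[OF DG_deriv t w])
    from sub[OF this]
    have "(\<lambda>k. m (s k) \<bullet> blinfun_apply ((DG (z (s k)) - DG zb) /\<^sub>R t (s k)) (0, u)) \<longlonglongrightarrow> \<mu> \<bullet> G'' v (0, u)"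
      by (intro tendsto_inner \<mu>' blinfun.tendsto tendsto_const)
    moreover have "(\<lambda>k. m (s k) \<bullet> blinfun_apply ((DG (z (s k)) - DG zb) /\<^sub>R t (s k)) (0, u)) \<longlonglongrightarrow> vs \<bullet> u"
    proof (rule Lim_transform_eventually)
      show "(\<lambda>k. y (s k) \<bullet> u) \<longlonglongrightarrow> vs \<bullet> u"
        by (intro tendsto_intros sub[OF y])
      show "\<forall>\<^sub>F k in sequentially. y (s k) \<bullet> u
          = m (s k) \<bullet> blinfun_apply ((DG (z (s k)) - DG zb) /\<^sub>R t (s k)) (0, u)"
        using sball
      proof eventually_elim
        case (elim k)
        show ?case using m(4)[OF elim, of u] t(1)[of "s k"] zero[of "s k"] xs0
          by (simp add: blinfun.diff_left blinfun.scaleR_left inner_diff_right inner_add_left field_simps)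
      qed
    qed
    ultimately show ?thesis using LIMSEQ_unique by fastforce
  qed
  show thesis by (rule that[OF \<mu>K xsu vK \<mu>v vsu])
qed

section \<open>Taylor estimates around \<open>zb\<close>\<close>

lemma DDG_bound:
  obtains c where "c \<ge> 0" "\<And>y. norm (DDG y) \<le> c * norm y"
  using bounded_linear.nonneg_bounded[OF has_derivative_bounded_linear[OF DG_deriv]]
  by (metis mult.commute)

lemma DG_near:
  assumes "\<eta> > 0"
  obtains \<delta> where "\<delta> > 0" "\<delta> \<le> \<rho>" "\<delta> \<le> 1"
    "\<And>z. z \<in> ball zb \<delta> \<Longrightarrow> norm (DG z - DG zb - DDG (z - zb)) \<le> \<eta> * norm (z - zb)"
proof -
  obtain d where "d > 0" "\<And>z. norm (z - zb) < d \<Longrightarrow> norm (DG z - DG zb - DDG (z - zb)) \<le> \<eta> * norm (z - zb)"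
    using DG_deriv assms unfolding has_derivative_at_alt by blast
  then show thesis using \<rho>
    by (intro that[of "min d (min \<rho> 1)"]) (auto simp: dist_norm norm_minus_commute)
qed

lemma segment_ball: "z \<in> ball zb \<delta> \<Longrightarrow> z' \<in> ball zb \<delta> \<Longrightarrow> closed_segment z z' \<subseteq> ball zb \<delta>"
  by (simp add: closed_segment_subset)

text \<open>The expansion of \<open>DG\<close> is centred at \<open>zb\<close>, so
  \<open>DG x - DG z\<close> on the segment is compared through \<open>zb\<close>. This leaves the
  term \<open>2 * norm (z - zb)\<close>, which does not shrink with \<open>z' - z\<close> but
  carries the small factor \<open>\<eta>\<close>.\<close>

lemma G_taylor:
  assumes c: "c \<ge> 0" "\<And>y. norm (DDG y) \<le> c * norm y" and \<eta>: "\<eta> > 0" and \<delta>: "\<delta> \<le> \<rho>"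
    and near: "\<And>z. z \<in> ball zb \<delta> \<Longrightarrow> norm (DG z - DG zb - DDG (z - zb)) \<le> \<eta> * norm (z - zb)"
    and z: "z \<in> ball zb \<delta>" "z' \<in> ball zb \<delta>"
  shows "norm (G z' - G z - G' z (z' - z))
    \<le> norm (z' - z) * (c * norm (z' - z) + \<eta> * (2 * norm (z - zb) + norm (z' - z)))"
proof (rule differentiable_bound_linearization[where S = "closed_segment z z'" and f' = G' and ?x0.0 = z])
  fix t :: real assume "t \<in> {0..1}"
  then show "z + t *\<^sub>R (z' - z) \<in> closed_segment z z'"
    by (auto simp: in_segment algebra_simps)
next
  fix x assume "x \<in> closed_segment z z'"
  then have "x \<in> ball zb \<rho>" using segment_ball[OF z] \<delta> by auto
  then show "(G has_derivative G' x) (at x within closed_segment z z')"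
    using G_deriv has_derivative_at_withinI by blast
next
  fix x assume x: "x \<in> closed_segment z z'"
  then have xb: "x \<in> ball zb \<delta>" using segment_ball[OF z] by auto
  have xz: "norm (x - z) \<le> norm (z' - z)"
    using segment_bound(1)[OF x] by (simp add: norm_minus_commute)
  have "norm (x - zb) \<le> norm (x - z) + norm (z - zb)"
    using norm_triangle_ineq[of "x - z" "z - zb"] by simp
  then have xzb: "norm (x - zb) \<le> norm (z' - z) + norm (z - zb)" using xz by linarith
  have lin: "linear DDG" using has_derivative_linear[OF DG_deriv] .
  have "DG x - DG z = (DG x - DG zb - DDG (x - zb)) - (DG z - DG zb - DDG (z - zb)) + DDG (x - z)"
    by (simp add: linear_diff[OF lin])
  also have "norm \<dots> \<le> norm (DG x - DG zb - DDG (x - zb)) + norm (DG z - DG zb - DDG (z - zb)) + norm (DDG (x - z))"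
    by (intro order_trans[OF norm_triangle_ineq] add_mono norm_triangle_ineq4 order_refl)
  also have "\<dots> \<le> \<eta> * norm (x - zb) + \<eta> * norm (z - zb) + c * norm (x - z)"
    using near[OF xb] near[OF z(1)] c(2)[of "x - z"] by linarith
  also have "\<dots> \<le> \<eta> * (norm (z' - z) + norm (z - zb)) + \<eta> * norm (z - zb) + c * norm (z' - z)"
    using mult_left_mono[OF xzb less_imp_le[OF \<eta>]] mult_left_mono[OF xz c(1)] by linarith
  also have "\<dots> = c * norm (z' - z) + \<eta> * (2 * norm (z - zb) + norm (z' - z))"
    by (simp add: algebra_simps)
  finally have "onorm (blinfun_apply (DG x - DG z)) \<le> c * norm (z' - z) + \<eta> * (2 * norm (z - zb) + norm (z' - z))"
    by (simp add: norm_blinfun.rep_eq)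
  moreover have "G' x - G' z = blinfun_apply (DG x - DG z)" by (simp add: fun_eq_iff blinfun.diff_left)
  ultimately show "onorm (G' x - G' z) \<le> c * norm (z' - z) + \<eta> * (2 * norm (z - zb) + norm (z' - z))"
    by simp
qed simp

lemma G_lipschitz:
  obtains L \<delta> where "L \<ge> 0" "\<delta> > 0" "\<delta> \<le> \<rho>"
    "\<And>z z'. z \<in> ball zb \<delta> \<Longrightarrow> z' \<in> ball zb \<delta> \<Longrightarrow> norm (G z' - G z) \<le> L * norm (z' - z)"
proof -
  have "isCont DG zb" using has_derivative_continuous[OF DG_deriv] .
  then obtain d where d: "d > 0" "\<And>z. dist z zb < d \<Longrightarrow> dist (DG z) (DG zb) < 1"
    unfolding continuous_at_eps_delta by (metis zero_less_one)
  define \<delta> where "\<delta> = min d \<rho>"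
  show thesis
  proof (rule that[of "norm (DG zb) + 1" \<delta>])
    fix z z' assume z: "z \<in> ball zb \<delta>" "z' \<in> ball zb \<delta>"
    show "norm (G z' - G z) \<le> (norm (DG zb) + 1) * norm (z' - z)"
    proof (rule differentiable_bound[where S = "ball zb \<delta>"])
      fix x assume x: "x \<in> ball zb \<delta>"
      then show "(G has_derivative G' x) (at x within ball zb \<delta>)"
        using G_deriv[of x] by (auto simp: \<delta>_def intro: has_derivative_at_withinI)
      have "norm (DG x - DG zb) < 1" using d(2)[of x] x by (simp add: \<delta>_def dist_norm norm_minus_commute)
      then show "onorm (G' x) \<le> norm (DG zb) + 1"
        using norm_triangle_sub[of "DG x" "DG zb"] by (simp add: norm_blinfun.rep_eq)
    qed (use z in auto)
  qed (use d \<rho> in \<open>auto simp: \<delta>_def\<close>)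
qed

text \<open>The mean value inequality is applied on the unit interval to the defect \<open>f\<close>
  of the quadratic model along the ray through \<open>w\<close>. The derivative of \<open>f\<close>
  involves only \<open>DG\<close> minus its linear model at \<open>zb\<close>, so differentiability
  of \<open>DG\<close> at that point controls it.\<close>

lemma G_second_order:
  assumes \<eta>: "\<eta> > 0"
  obtains \<delta> where "\<delta> > 0" "\<delta> \<le> \<rho>"
    "\<And>w. norm w < \<delta> \<Longrightarrow> norm (G (zb + w) - G' zb w - (1/2) *\<^sub>R G'' w w) \<le> \<eta> * (norm w)\<^sup>2"
proof -
  obtain \<delta> where \<delta>: "\<delta> > 0" "\<delta> \<le> \<rho>" "\<delta> \<le> 1"
    and near: "\<And>z. z \<in> ball zb \<delta> \<Longrightarrow> norm (DG z - DG zb - DDG (z - zb)) \<le> \<eta> * norm (z - zb)"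
    using DG_near[OF \<eta>] by metis
  have lin: "linear DDG" using has_derivative_linear[OF DG_deriv] .
  show thesis
  proof (rule that[OF \<delta>(1,2)])
    fix w :: "'p \<times> 'x" assume w: "norm w < \<delta>"
    define f where "f \<tau> = G (zb + \<tau> *\<^sub>R w) - \<tau> *\<^sub>R G' zb w - (\<tau>\<^sup>2 / 2) *\<^sub>R G'' w w" for \<tau> :: real
    have ball: "zb + \<tau> *\<^sub>R w \<in> ball zb \<delta>" if "\<tau> \<in> {0..1}" for \<tau>
      using w that mult_left_le_one_le[of "norm w" \<tau>] by (auto simp: dist_norm)
    have "norm (f 1 - f 0) \<le> \<eta> * (norm w)\<^sup>2 * norm (1 - 0 :: real)"
    proof (rule differentiable_bound[where S = "{0..1}"])
      fix \<tau> :: real assume \<tau>: "\<tau> \<in> {0..1}"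
      define D where "D = G' (zb + \<tau> *\<^sub>R w) w - G' zb w - \<tau> *\<^sub>R G'' w w"
      have "(G has_derivative G' (zb + \<tau> *\<^sub>R w)) (at (zb + \<tau> *\<^sub>R w))"
        using G_deriv ball[OF \<tau>] \<delta> by auto
      moreover have "((\<lambda>\<tau>. zb + \<tau> *\<^sub>R w) has_derivative (\<lambda>h. h *\<^sub>R w)) (at \<tau> within {0..1})"
        by (auto intro!: derivative_eq_intros)
      ultimately have "((\<lambda>\<tau>. G (zb + \<tau> *\<^sub>R w)) has_derivative (\<lambda>h. G' (zb + \<tau> *\<^sub>R w) (h *\<^sub>R w))) (at \<tau> within {0..1})"
        by (rule has_derivative_compose[rotated])
      then show "(f has_derivative (\<lambda>h. h *\<^sub>R D)) (at \<tau> within {0..1})"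
        unfolding f_def[abs_def] D_def
        by (auto intro!: derivative_eq_intros simp: blinfun.scaleR_right algebra_simps)
      have "D = blinfun_apply (DG (zb + \<tau> *\<^sub>R w) - DG zb - DDG (\<tau> *\<^sub>R w)) w"
        by (simp add: D_def blinfun.diff_left blinfun.scaleR_left linear_scale[OF lin])
      also have "norm \<dots> \<le> norm (DG (zb + \<tau> *\<^sub>R w) - DG zb - DDG (\<tau> *\<^sub>R w)) * norm w"
        by (rule norm_blinfun)
      also have "\<dots> \<le> \<eta> * norm (\<tau> *\<^sub>R w) * norm w"
        using near[OF ball[OF \<tau>]] by (intro mult_right_mono) auto
      also have "\<dots> \<le> \<eta> * (norm w)\<^sup>2"
        using \<tau> \<eta> by (simp add: power2_eq_square mult_left_le_one_le mult_left_mono flip: mult.assoc)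
          (smt (verit) mult_left_le_one_le mult_left_mono mult_nonneg_nonneg mult.assoc mult.commute norm_ge_zero)
      finally have "norm D \<le> \<eta> * (norm w)\<^sup>2" .
      then show "onorm (\<lambda>h. h *\<^sub>R D) \<le> \<eta> * (norm w)\<^sup>2"
        using \<eta> by (intro onorm_bound) (auto simp: mult.commute[of "\<eta> * (norm w)\<^sup>2"] mult_left_mono)
    qed auto
    then show "norm (G (zb + w) - G' zb w - (1/2) *\<^sub>R G'' w w) \<le> \<eta> * (norm w)\<^sup>2"
      by (simp add: f_def G0)
  qed
qed

end

section \<open>Construction of normals along a feasible arc\<close>

text \<open>If \<open>d\<close> exceeded \<open>\<alpha> * t\<close>, each of the two terms on the
  right would be at most half of \<open>d\<^sup>2\<close>, the first one strictly less.\<close>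

lemma quadratic_bound:
  fixes d t \<alpha> \<eta> B :: real
  assumes "d \<ge> 0" "t > 0" "\<alpha> > 0" and le: "d\<^sup>2 \<le> \<eta> * t\<^sup>2 + B * (t * d)"
    and \<eta>: "\<eta> \<le> \<alpha>\<^sup>2 / 2" and B: "B \<le> \<alpha> / 2"
  shows "d \<le> \<alpha> * t"
proof (rule ccontr)
  assume "\<not> d \<le> \<alpha> * t"
  then have d: "\<alpha> * t < d" by simp
  have "0 < \<alpha> * t" using assms by simp
  then have "(\<alpha> * t)\<^sup>2 < d\<^sup>2" using d by (intro power_strict_mono) auto
  moreover have "(\<alpha> * t) * d \<le> d * d" using d assms by (intro mult_right_mono) auto
  moreover have "\<eta> * t\<^sup>2 \<le> \<alpha>\<^sup>2 / 2 * t\<^sup>2" using \<eta> by (intro mult_right_mono) auto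
  moreover have "B * (t * d) \<le> \<alpha> / 2 * (t * d)" using B assms by (intro mult_right_mono) auto
  ultimately show False using le by (simp add: power2_eq_square algebra_simps)
qed

context reduced_system
begin

lemma lin_subspace: "subspace (lin_cone K)"
  using lin_cone_subspace K K0 by blast

text \<open>Along the parabola \<open>t v + (t\<^sup>2 / 2) s\<close> the first and second order
  parts of \<open>G\<close> both lie in \<open>lin_cone K\<close>; they form \<open>l\<close>.
  Robinson stability then reaches a feasible point at a cost of o(t^2), so the value of
  \<open>G\<close> stays that close to \<open>l\<close>.\<close>

lemma feasible_arc:
  assumes v: "G' zb v \<in> lin_cone K" and s: "G' zb s + G'' v v \<in> lin_cone K" and \<eta>: "\<eta> > 0"
  shows "\<forall>\<^sub>F t in at_right 0. \<exists>z l. z \<in> gph \<Gamma> \<and> norm (z - zb - t *\<^sub>R v) \<le> t * \<eta> \<and>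
           l \<in> lin_cone K \<and> norm (G z - l) \<le> \<eta> * t\<^sup>2"
proof -
  obtain c where c: "c \<ge> 0" "\<And>y. norm (DDG y) \<le> c * norm y" using DDG_bound by metis
  obtain L \<delta>1 where L: "L \<ge> 0" "\<delta>1 > 0" "\<delta>1 \<le> \<rho>"
    "\<And>z z'. z \<in> ball zb \<delta>1 \<Longrightarrow> z' \<in> ball zb \<delta>1 \<Longrightarrow> norm (G z' - G z) \<le> L * norm (z' - z)"
    using G_lipschitz by metis
  \<comment> \<open>The repair moves the point by at most
    \<open>(\<kappa> + 1) * \<eta>0 * t\<^sup>2\<close> and \<open>G\<close> by at most
    \<open>L\<close> times as much; the last 1 pays for the error before the repair.\<close>
  define \<eta>0 where "\<eta>0 = \<eta> / (L * (\<kappa> + 1) + 1)"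
  have pos: "L * (\<kappa> + 1) + 1 > 0" using L \<kappa> by (simp add: add_nonneg_pos)
  have \<eta>0: "\<eta>0 > 0" "\<eta>0 * (L * (\<kappa> + 1) + 1) = \<eta>"
    using pos \<eta> by (simp_all add: \<eta>0_def)
  define N where "N = norm v + norm s + 1"
  have N: "N \<ge> 1" "norm v \<le> N" "norm s \<le> N" by (auto simp: N_def)
  define \<eta>1 where "\<eta>1 = \<eta>0 / (2 * N\<^sup>2)"
  have \<eta>1: "\<eta>1 > 0" "\<eta>1 * N\<^sup>2 = \<eta>0 / 2" using \<eta>0 N by (auto simp: \<eta>1_def)
  obtain \<delta>2 where \<delta>2: "\<delta>2 > 0" "\<delta>2 \<le> \<rho>"
    "\<And>w. norm w < \<delta>2 \<Longrightarrow> norm (G (zb + w) - G' zb w - (1/2) *\<^sub>R G'' w w) \<le> \<eta>1 * (norm w)\<^sup>2"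
    using G_second_order[OF \<eta>1(1)] by metis
  define \<delta> where "\<delta> = min \<delta>1 \<delta>2"
  have \<delta>: "\<delta> > 0" using L \<delta>2 by (simp add: \<delta>_def)
  have "\<forall>\<^sub>F t in at_right (0::real). 0 < t" by (rule eventually_at_right_less)
  moreover have "\<forall>\<^sub>F t in at_right 0. t * 1 < (1::real)" by (rule eventually_scaled_less) simp
  moreover have "\<forall>\<^sub>F t in at_right 0. t * (N + (\<kappa> + 1) * \<eta>0) < \<delta>" by (rule eventually_scaled_less) fact
  moreover have "\<forall>\<^sub>F t in at_right 0. t * (c * N\<^sup>2) < \<eta>0 / 2" by (rule eventually_scaled_less) (use \<eta>0 in simp)
  moreover have "\<forall>\<^sub>F t in at_right 0. t * (norm s + (\<kappa> + 1) * \<eta>0) < \<eta>" by (rule eventually_scaled_less) fact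
  ultimately show ?thesis
  proof eventually_elim
    case (elim t)
    then have t0: "t > 0" and t1: "t < 1" by auto
    have t2: "t\<^sup>2 \<le> t" using t0 t1 by (simp add: power2_eq_square mult_left_le)
    have k\<eta>: "(\<kappa> + 1) * \<eta>0 \<ge> 0" using \<kappa> \<eta>0 by simp
    define y where "y = t *\<^sub>R v + (t\<^sup>2 / 2) *\<^sub>R s"
    have ytv: "norm (y - t *\<^sub>R v) = t\<^sup>2 / 2 * norm s" by (simp add: y_def)
    also have "\<dots> \<le> t * norm s" using t2 t0 by (intro mult_right_mono) auto
    finally have ytv1: "norm (y - t *\<^sub>R v) \<le> t * norm s" .
    have ntv: "norm (t *\<^sub>R v) = t * norm v" using t0 by simp
    have yn: "norm y \<le> t * N"
      using norm_triangle_sub[of y "t *\<^sub>R v"] ytv1 ntv t0 by (simp add: N_def algebra_simps)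
    also have "t * N \<le> t * (N + (\<kappa> + 1) * \<eta>0)" using t0 k\<eta> by (intro mult_left_mono) auto
    finally have y\<delta>: "norm y < \<delta>" using elim by linarith
    define l where "l = t *\<^sub>R G' zb v + (t\<^sup>2 / 2) *\<^sub>R (G' zb s + G'' v v)"
    have l: "l \<in> lin_cone K"
      unfolding l_def
      by (rule subspace_add[OF lin_subspace subspace_scale[OF lin_subspace v] subspace_scale[OF lin_subspace s]])
    have lin: "linear DDG" using has_derivative_linear[OF DG_deriv] .
    have "norm (G (zb + y) - l) \<le> \<eta>0 * t\<^sup>2"
    proof -
      \<comment> \<open>This is \<open>G'' y y - G'' (t v) (t v)\<close>, split bilinearly. One
        factor is always \<open>y - t v\<close>, of order t^2, so \<open>a\<close> is of order
        t^3.\<close>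
      define a where "a = G'' y (y - t *\<^sub>R v) + G'' (y - t *\<^sub>R v) (t *\<^sub>R v)"
      have a: "G' zb y + (1/2) *\<^sub>R G'' y y - l = (1/2) *\<^sub>R a"
        by (simp add: a_def l_def y_def linear_add[OF lin] linear_diff[OF lin] linear_scale[OF lin]
            blinfun.add_right blinfun.add_left blinfun.diff_right blinfun.diff_left blinfun.scaleR_right
            blinfun.scaleR_left scaleR_add_right power2_eq_square)
      have bnd: "norm (G'' p q) \<le> c * norm p * norm q" for p q
        using norm_blinfun[of "DDG p" q] mult_right_mono[OF c(2)[of p] norm_ge_zero[of q]] by linarith
      have ytv2: "norm (y - t *\<^sub>R v) \<le> t\<^sup>2 / 2 * N" using ytv N by (simp add: mult_left_mono)
      have tN: "norm (t *\<^sub>R v) \<le> t * N" using ntv N t0 by simp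
      have "norm a \<le> c * norm y * norm (y - t *\<^sub>R v) + c * norm (y - t *\<^sub>R v) * norm (t *\<^sub>R v)"
        unfolding a_def by (intro order_trans[OF norm_triangle_ineq] add_mono bnd)
      also have "\<dots> \<le> c * (t * N) * (t\<^sup>2 / 2 * N) + c * (t\<^sup>2 / 2 * N) * (t * N)"
        using c(1) N t0 yn ytv2 tN by (intro add_mono mult_mono mult_nonneg_nonneg) auto
      also have "\<dots> = t\<^sup>2 * (t * (c * N\<^sup>2))" by (simp add: power2_eq_square)
      also have "\<dots> \<le> t\<^sup>2 * (\<eta>0 / 2)" using elim by (intro mult_left_mono) auto
      finally have na: "norm a \<le> t\<^sup>2 * (\<eta>0 / 2)" .
      have "norm (G (zb + y) - G' zb y - (1/2) *\<^sub>R G'' y y) \<le> \<eta>1 * (norm y)\<^sup>2"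
        using \<delta>2(3) y\<delta> by (simp add: \<delta>_def)
      also have "\<dots> \<le> \<eta>1 * (t * N)\<^sup>2" using \<eta>1 yn by (intro mult_left_mono power_mono) auto
      also have "\<dots> = t\<^sup>2 * (\<eta>1 * N\<^sup>2)" by (simp add: power_mult_distrib)
      also have "\<dots> = t\<^sup>2 * (\<eta>0 / 2)" unfolding \<eta>1 ..
      finally have n1: "norm (G (zb + y) - G' zb y - (1/2) *\<^sub>R G'' y y) \<le> t\<^sup>2 * (\<eta>0 / 2)" .
      have "G (zb + y) - l = (G (zb + y) - G' zb y - (1/2) *\<^sub>R G'' y y) + (1/2) *\<^sub>R a"
        unfolding a[symmetric] by simp
      also have "norm \<dots> \<le> t\<^sup>2 * (\<eta>0 / 2) + norm a / 2"
        by (rule order_trans[OF norm_triangle_ineq]) (use n1 in simp)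
      also have "\<dots> \<le> t\<^sup>2 * (\<eta>0 / 2) + t\<^sup>2 * (\<eta>0 / 2)" using na norm_ge_zero[of a] by linarith
      finally show ?thesis by (simp add: mult.commute)
    qed
    note Gl = this
    have "l \<in> K" using l by (simp add: mem_lin_cone_iff)
    from infdist_le_norm[OF this, of "G (zb + y)"] Gl
    have inf: "infdist (G (zb + y)) K \<le> \<eta>0 * t\<^sup>2" by linarith
    have ball: "zb + y \<in> ball zb \<delta>1" "zb + y \<in> ball zb \<rho>"
      using y\<delta> L(3) by (auto simp: \<delta>_def dist_norm)
    have "\<eta>0 * t\<^sup>2 > 0" using \<eta>0 t0 by simp
    from RS[OF ball(2) this] obtain x' where x': "x' \<in> \<Gamma> (fst (zb + y))"
      "norm (x' - snd (zb + y)) \<le> \<kappa> * infdist (G (zb + y)) K + \<eta>0 * t\<^sup>2" by blast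
    define z where "z = (fst (zb + y), x')"
    have "norm (z - (zb + y)) = norm (x' - snd (zb + y))"
      by (simp add: z_def norm_prod_def)
    also have "\<dots> \<le> \<kappa> * (\<eta>0 * t\<^sup>2) + \<eta>0 * t\<^sup>2"
      using x'(2) mult_left_mono[OF inf \<kappa>] by linarith
    finally have zy: "norm (z - (zb + y)) \<le> t\<^sup>2 * ((\<kappa> + 1) * \<eta>0)" by (simp add: algebra_simps)
    have zy1: "t\<^sup>2 * ((\<kappa> + 1) * \<eta>0) \<le> t * ((\<kappa> + 1) * \<eta>0)" using t2 k\<eta> by (rule mult_right_mono)
    have "norm (z - zb - t *\<^sub>R v) \<le> norm (z - (zb + y)) + norm (y - t *\<^sub>R v)"
      using norm_triangle_ineq[of "z - (zb + y)" "y - t *\<^sub>R v"] by (simp add: algebra_simps)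
    also have "\<dots> \<le> t\<^sup>2 * ((\<kappa> + 1) * \<eta>0) + t\<^sup>2 * norm s"
    proof -
      have "0 \<le> t\<^sup>2 * norm s" by simp
      moreover have "norm (y - t *\<^sub>R v) = (t\<^sup>2 * norm s) / 2" using ytv by simp
      ultimately show ?thesis using zy by linarith
    qed
    also have "\<dots> = t * (t * (norm s + (\<kappa> + 1) * \<eta>0))" by (simp add: power2_eq_square algebra_simps)
    also have "\<dots> \<le> t * \<eta>" using elim by (intro mult_left_mono) auto
    finally have ztv: "norm (z - zb - t *\<^sub>R v) \<le> t * \<eta>" .
    have "norm (z - zb) \<le> norm (z - (zb + y)) + norm y"
      using norm_triangle_ineq[of "z - (zb + y)" y] by (simp add: algebra_simps)
    also have "\<dots> \<le> t * (N + (\<kappa> + 1) * \<eta>0)" using zy zy1 yn by (simp add: algebra_simps)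
    also have "\<dots> < \<delta>" using elim by simp
    finally have zball: "z \<in> ball zb \<delta>1" by (simp add: \<delta>_def dist_norm norm_minus_commute)
    have "norm (G z - l) \<le> norm (G z - G (zb + y)) + norm (G (zb + y) - l)"
      using norm_triangle_ineq[of "G z - G (zb + y)" "G (zb + y) - l"] by simp
    also have "\<dots> \<le> L * (t\<^sup>2 * ((\<kappa> + 1) * \<eta>0)) + \<eta>0 * t\<^sup>2"
      using L(4)[OF ball(1) zball] mult_left_mono[OF zy L(1)] Gl by linarith
    also have "\<dots> = \<eta>0 * (L * (\<kappa> + 1) + 1) * t\<^sup>2" by (simp add: algebra_simps)
    also have "\<dots> = \<eta> * t\<^sup>2" unfolding \<eta>0(2) ..
    finally have "norm (G z - l) \<le> \<eta> * t\<^sup>2" .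
    moreover have "z \<in> gph \<Gamma>" using x' by (simp add: z_def gph_def)
    ultimately show ?case using ztv l by blast
  qed
qed

text \<open>Moving from \<open>z1\<close> to \<open>z2\<close> changes \<open>G\<close> from nearly
  \<open>l\<close> to a point of \<open>K\<close>: polarity makes the pairing nonpositive at the end
  and zero at \<open>l\<close>. What remains is error, and its term quadratic in \<open>d\<close>
  comes from the Taylor remainder alone.\<close>

lemma pairing_estimate:
  assumes c: "c \<ge> 0" "\<And>y. norm (DDG y) \<le> c * norm y" and \<eta>: "\<eta> > 0" "\<eta> \<le> 1" and \<delta>: "\<delta> \<le> \<rho>"
    and near: "\<And>z. z \<in> ball zb \<delta> \<Longrightarrow> norm (DG z - DG zb - DDG (z - zb)) \<le> \<eta> * norm (z - zb)"
    and z: "z1 \<in> ball zb \<delta>" "z2 \<in> ball zb \<delta>" and d: "z2 - z1 = (0, d)"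
    and \<mu>: "\<mu> \<in> polar K" "norm \<mu> \<le> m" and z2: "G z2 \<in> K"
    and l: "l \<in> lin_cone K" "norm (G z1 - l) \<le> \<eta> * t\<^sup>2"
    and z1: "norm (z1 - zb - t *\<^sub>R v) \<le> t * \<eta>" and t: "t > 0"
  shows "\<mu> \<bullet> (G' zb (0, d) + t *\<^sub>R G'' v (0, d))
    \<le> m * \<eta> * t\<^sup>2 + m * \<eta> * (3 * (norm v + 1) + c) * (t * norm d) + m * (c + 1) * (norm d)\<^sup>2"
proof -
  have m: "m \<ge> 0" using \<mu>(2) norm_ge_zero[of \<mu>] by linarith
  have lin: "linear DDG" using has_derivative_linear[OF DG_deriv] .
  have z1b: "norm (z1 - zb) \<le> t * (norm v + 1)"
  proof -
    have "norm (z1 - zb) \<le> norm (z1 - zb - t *\<^sub>R v) + norm (t *\<^sub>R v)"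
      using norm_triangle_ineq[of "z1 - zb - t *\<^sub>R v" "t *\<^sub>R v"] by simp
    moreover have "t * \<eta> \<le> t * 1" using t \<eta> by simp
    moreover have "norm (t *\<^sub>R v) = t * norm v" using t by simp
    ultimately show ?thesis using z1 unfolding distrib_left by linarith
  qed
  have nd: "norm (0::'p, d) = norm d" by (simp add: norm_prod_def)
  have in_le: "\<mu> \<bullet> a \<le> m * norm a" for a
    using norm_cauchy_schwarz[of \<mu> a] mult_right_mono[OF \<mu>(2) norm_ge_zero[of a]] by linarith
  define E where "E = DG z1 - DG zb - t *\<^sub>R DDG v"
  have "E = (DG z1 - DG zb - DDG (z1 - zb)) + DDG (z1 - zb - t *\<^sub>R v)"
    by (simp add: E_def linear_diff[OF lin] linear_scale[OF lin])
  also have "norm \<dots> \<le> \<eta> * norm (z1 - zb) + c * norm (z1 - zb - t *\<^sub>R v)"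
    by (rule order_trans[OF norm_triangle_ineq]) (intro add_mono near z c)
  also have "\<dots> \<le> \<eta> * (t * (norm v + 1)) + c * (t * \<eta>)"
    using z1b z1 \<eta> c by (intro add_mono mult_left_mono) auto
  finally have E: "norm E \<le> \<eta> * (t * (norm v + 1)) + c * (t * \<eta>)" .
  define R where "R = G z2 - G z1 - G' z1 (0, d)"
  have "norm R \<le> norm d * (c * norm d + \<eta> * (2 * norm (z1 - zb) + norm d))"
    using G_taylor[OF c \<eta>(1) \<delta> near z] by (simp add: R_def d nd)
  also have "\<dots> \<le> norm d * (c * norm d + (\<eta> * (2 * (t * (norm v + 1))) + 1 * norm d))"
  proof -
    have "\<eta> * (2 * norm (z1 - zb)) \<le> \<eta> * (2 * (t * (norm v + 1)))" using z1b \<eta> by simp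
    moreover have "\<eta> * norm d \<le> 1 * norm d" using \<eta> by (intro mult_right_mono) auto
    ultimately show ?thesis by (intro mult_left_mono add_left_mono) (simp_all add: distrib_left[of \<eta>])
  qed
  finally have R: "norm R \<le> norm d * (c * norm d + (\<eta> * (2 * (t * (norm v + 1))) + 1 * norm d))" .
  \<comment> \<open>\<open>R\<close> is the Taylor remainder from \<open>z1\<close> to
    \<open>z2\<close> and \<open>E\<close> the defect of the first-order model of \<open>DG\<close>
    at \<open>z1\<close>. In the final coefficient, the 3 counts \<open>norm v + 1\<close> twice
    from \<open>R\<close> and once from \<open>E\<close>.\<close>
  have "G' zb (0, d) + t *\<^sub>R G'' v (0, d) = G z2 + (- (G z1 - l)) + (- R) + (- blinfun_apply E (0, d)) - l"
    by (simp add: R_def E_def blinfun.diff_left blinfun.scaleR_left)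
  then have "\<mu> \<bullet> (G' zb (0, d) + t *\<^sub>R G'' v (0, d))
      = \<mu> \<bullet> G z2 + \<mu> \<bullet> (- (G z1 - l)) + \<mu> \<bullet> (- R) + \<mu> \<bullet> (- blinfun_apply E (0, d)) - \<mu> \<bullet> l"
    by (simp only: inner_add_right inner_diff_right)
  also have "\<dots> \<le> 0 + m * (\<eta> * t\<^sup>2) + m * (norm d * (c * norm d + (\<eta> * (2 * (t * (norm v + 1))) + 1 * norm d)))
      + m * ((\<eta> * (t * (norm v + 1)) + c * (t * \<eta>)) * norm d) - 0"
  proof (intro diff_mono add_mono)
    show "\<mu> \<bullet> G z2 \<le> 0" using \<mu> z2 by (simp add: polar_def)
    show "\<mu> \<bullet> (- (G z1 - l)) \<le> m * (\<eta> * t\<^sup>2)"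
      using in_le[of "- (G z1 - l)"] mult_left_mono[OF l(2) m] unfolding norm_minus_cancel by linarith
    show "\<mu> \<bullet> (- R) \<le> m * (norm d * (c * norm d + (\<eta> * (2 * (t * (norm v + 1))) + 1 * norm d)))"
      using in_le[of "- R"] mult_left_mono[OF R m] unfolding norm_minus_cancel by linarith
    have "norm (blinfun_apply E (0, d)) \<le> (\<eta> * (t * (norm v + 1)) + c * (t * \<eta>)) * norm d"
      using norm_blinfun[of E "(0, d)"] mult_right_mono[OF E norm_ge_zero[of d]] unfolding nd by linarith
    from mult_left_mono[OF this m]
    show "\<mu> \<bullet> (- blinfun_apply E (0, d)) \<le> m * ((\<eta> * (t * (norm v + 1)) + c * (t * \<eta>)) * norm d)"
      using in_le[of "- blinfun_apply E (0, d)"] unfolding norm_minus_cancel by linarith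
    show "0 \<le> \<mu> \<bullet> l" using polar_lin_cone[OF \<mu>(1) l(1)] by simp
  qed
  also have "\<dots> = m * \<eta> * t\<^sup>2 + m * \<eta> * (3 * (norm v + 1) + c) * (t * norm d) + m * (c + 1) * (norm d)\<^sup>2"
    by (simp add: power2_eq_square algebra_simps)
  finally show ?thesis .
qed

text \<open>Closedness of the slice is known only where \<open>\<Gamma>\<close> is described by
  \<open>G\<close>, so the projection is confined to a closed ball inside that region.\<close>

lemma slice_closest:
  assumes r: "r < \<rho>" and x1: "(p, x1) \<in> cball zb r" "x1 \<in> \<Gamma> p"
  obtains x2 where "(p, x2) \<in> cball zb r" "x2 \<in> \<Gamma> p"
    "\<And>x. (p, x) \<in> cball zb r \<Longrightarrow> x \<in> \<Gamma> p \<Longrightarrow> norm (y - x2) \<le> norm (y - x)"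
proof -
  define S where "S = Pair p -` cball zb r"
  have sub: "(p, x) \<in> ball zb \<rho>" if "x \<in> S" for x using that r by (auto simp: S_def)
  have "closed S" unfolding S_def by (intro closed_vimage continuous_intros closed_cball)
  moreover have "continuous_on S (\<lambda>x. G (p, x))"
  proof (rule continuous_on_compose2[of "ball zb \<rho>" G])
    show "continuous_on (ball zb \<rho>) G"
      using G_deriv has_derivative_continuous continuous_at_imp_continuous_on by blast
  qed (use sub in \<open>auto intro!: continuous_intros\<close>)
  ultimately have "closed (S \<inter> (\<lambda>x. G (p, x)) -` K)"
    using K(1) continuous_closed_preimage by blast
  moreover have \<Omega>: "x \<in> S \<inter> (\<lambda>x. G (p, x)) -` K \<longleftrightarrow> (p, x) \<in> cball zb r \<and> x \<in> \<Gamma> p" for x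
    using \<Gamma>_iff[of "(p, x)"] sub[of x] by (auto simp: S_def)
  moreover have "S \<inter> (\<lambda>x. G (p, x)) -` K \<noteq> {}" using \<Omega> x1 by blast
  ultimately obtain x2 where "x2 \<in> S \<inter> (\<lambda>x. G (p, x)) -` K"
    "\<And>x. x \<in> S \<inter> (\<lambda>x. G (p, x)) -` K \<Longrightarrow> dist y x2 \<le> dist y x"
    using distance_attains_inf by metis
  then show thesis using that \<Omega> by (simp add: dist_norm) metis
qed

text \<open>Elements of the graph of \<open>\<Psi>\<close> are produced by projecting \<open>x\<^sub>t + \<sigma> (xs + t vs)\<close> onto
  \<open>\<Gamma> p\<^sub>t\<close> with a \<^emph>\<open>fixed\<close> small step \<open>\<sigma>\<close>, where \<open>(p\<^sub>t, x\<^sub>t)\<close> is the feasible arc. Moving the multiplier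
  slightly towards the relative interior point \<open>\<mu>b\<close> makes room in the polar cone for the perturbation \<open>t \<nu>\<close>.\<close>

lemma graphical_derivativeI:
  assumes \<mu>: "\<mu> \<in> polar K" "\<And>u. xs \<bullet> u = \<mu> \<bullet> G' zb (0, u)"
    and \<mu>b: "\<mu>b \<in> polar K" "\<And>u. xs \<bullet> u = \<mu>b \<bullet> G' zb (0, u)"
    and \<nu>: "e > 0" "\<mu>b + e *\<^sub>R \<nu> \<in> polar K"
    and v: "G' zb v \<in> lin_cone K" and s: "G' zb s + G'' v v \<in> lin_cone K"
    and vs: "\<And>u. vs \<bullet> u = \<mu> \<bullet> G'' v (0, u) + \<nu> \<bullet> G' zb (0, u)"
  shows "vs \<in> graphical_derivative \<Psi> zb xs v"
  unfolding graphical_derivative_def mem_Collect_eq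
proof (rule tangent_coneI)
  fix \<epsilon> :: real assume \<epsilon>: "\<epsilon> > 0"
  obtain c where c: "c \<ge> 0" "\<And>y. norm (DDG y) \<le> c * norm y" using DDG_bound by metis
  define m where "m = norm \<mu> + norm \<mu>b + norm \<nu> + 1"
  have m: "m \<ge> 1" by (simp add: m_def)
  \<comment> \<open>Chosen so that the term \<open>m * (c + 1) * (norm d)\<^sup>2\<close> of
    \<open>pairing_estimate\<close> is absorbed by half of the left side once the projection
    inequality is doubled.\<close>
  define \<sigma> where "\<sigma> = 1 / (4 * m * (c + 1))"
  have mc: "m * (c + 1) \<ge> 1" using m c mult_mono[of 1 m 1 "c + 1"] by simp
  then have mc': "4 * m * (c + 1) > 0" by (simp add: mult.assoc)
  then have \<sigma>: "\<sigma> > 0" "4 * \<sigma> * (m * (c + 1)) = 1"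
    using m c by (auto simp: \<sigma>_def)
  have \<sigma>m: "4 * \<sigma> * m \<le> 1"
  proof -
    have "4 * \<sigma> * (m * 1) \<le> 4 * \<sigma> * (m * (c + 1))" using \<sigma> m c by (intro mult_left_mono) auto
    then show ?thesis using \<sigma> by simp
  qed
  have \<sigma>1: "4 * \<sigma> \<le> 1"
  proof -
    have "4 * \<sigma> * 1 \<le> 4 * \<sigma> * m" using \<sigma> m by (intro mult_left_mono) auto
    then show ?thesis using \<sigma>m by simp
  qed
  \<comment> \<open>The target is \<open>norm d \<le> \<alpha> * t\<close>. The normal changes by
    \<open>d / \<sigma>\<close>, hence the factor \<open>\<sigma>\<close> in the first bound; the
    second controls the base point.\<close>
  define \<alpha> where "\<alpha> = min (\<sigma> * \<epsilon> / 2) (\<epsilon> / 4)"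
  have \<alpha>: "\<alpha> > 0" "\<alpha> \<le> \<sigma> * \<epsilon> / 2" "\<alpha> \<le> \<epsilon> / 4" using \<sigma> \<epsilon> by (auto simp: \<alpha>_def)
  define b1 where "b1 = m * c * norm v"
  have b1: "b1 \<ge> 0" using m c by (simp add: b1_def)
  define b2 where "b2 = m * (3 * (norm v + 1) + c)"
  have "3 * (norm v + 1) + c > 0" using c(1) norm_ge_zero[of v] by argo
  then have b2: "b2 > 0" using m by (simp add: b2_def)
  define \<theta> where "\<theta> = min 1 (\<alpha> / (8 * (b1 + 1)))"
  have \<theta>: "0 < \<theta>" "\<theta> \<le> 1" "b1 * \<theta> \<le> \<alpha> / 8"
  proof -
    show "0 < \<theta>" "\<theta> \<le> 1" using \<alpha> b1 by (auto simp: \<theta>_def)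
    have "b1 * \<theta> \<le> (b1 + 1) * (\<alpha> / (8 * (b1 + 1)))"
      using b1 \<open>0 < \<theta>\<close> by (intro mult_mono) (auto simp: \<theta>_def)
    also have "\<dots> = \<alpha> / 8" using b1 by (simp add: divide_eq_eq)
    finally show "b1 * \<theta> \<le> \<alpha> / 8" .
  qed
  define \<eta> where "\<eta> = min (min 1 (\<epsilon> / 4)) (min (\<alpha>\<^sup>2 / 2) (\<alpha> / (4 * b2)))"
  have \<eta>: "0 < \<eta>" "\<eta> \<le> 1" "\<eta> \<le> \<epsilon> / 4" "\<eta> \<le> \<alpha>\<^sup>2 / 2" "\<eta> * b2 \<le> \<alpha> / 4"
  proof -
    show "0 < \<eta>" "\<eta> \<le> 1" "\<eta> \<le> \<epsilon> / 4" "\<eta> \<le> \<alpha>\<^sup>2 / 2" using \<alpha> b2 \<epsilon> by (auto simp: \<eta>_def)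
    have "\<eta> * b2 \<le> \<alpha> / (4 * b2) * b2" using b2 by (intro mult_right_mono) (auto simp: \<eta>_def)
    then show "\<eta> * b2 \<le> \<alpha> / 4" using b2 by simp
  qed
  obtain \<delta> where \<delta>: "\<delta> > 0" "\<delta> \<le> \<rho>"
    and near: "\<And>z. z \<in> ball zb \<delta> \<Longrightarrow> norm (DG z - DG zb - DDG (z - zb)) \<le> \<eta> * norm (z - zb)"
    using DG_near[OF \<eta>(1)] by metis
  define r where "r = \<delta> / 2"
  have r: "r > 0" "r < \<delta>" "r < \<rho>" using \<delta> by (auto simp: r_def)
  have "\<forall>\<^sub>F t in at_right (0::real). 0 < t" by (rule eventually_at_right_less)
  moreover have "\<forall>\<^sub>F t in at_right 0. t * 1 < (1::real)" by (rule eventually_scaled_less) simp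
  moreover have "\<forall>\<^sub>F t in at_right 0. t * 1 < \<epsilon>" by (rule eventually_scaled_less) fact
  moreover have "\<forall>\<^sub>F t in at_right 0. t * 1 < \<theta> * e" by (rule eventually_scaled_less) (use \<theta> \<nu> in simp)
  moreover have "\<forall>\<^sub>F t in at_right 0. t * b1 < \<alpha> / 8" by (rule eventually_scaled_less) (use \<alpha> in simp)
  moreover have "\<forall>\<^sub>F t in at_right 0. t * (norm v + 1 + \<alpha>) < r" by (rule eventually_scaled_less) fact
  moreover note feasible_arc[OF v s \<eta>(1)]
  ultimately have "\<forall>\<^sub>F t in at_right 0. \<exists>w'. 0 < t \<and> t < \<epsilon> \<and> norm (w' - (v, vs)) \<le> \<epsilon> \<and>
      (zb, xs) + t *\<^sub>R w' \<in> gph \<Psi>"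
  proof eventually_elim
    case (elim t)
    then have t0: "t > 0" and t1: "t < 1" and t\<epsilon>: "t < \<epsilon>" by auto
    obtain z1 l where z1: "z1 \<in> gph \<Gamma>" "norm (z1 - zb - t *\<^sub>R v) \<le> t * \<eta>"
      and l: "l \<in> lin_cone K" "norm (G z1 - l) \<le> \<eta> * t\<^sup>2" using elim by blast
    obtain p x1 where z1px: "z1 = (p, x1)" by force
    have z1b: "norm (z1 - zb) \<le> t * (norm v + 1)"
    proof -
      have "norm (z1 - zb) \<le> norm (z1 - zb - t *\<^sub>R v) + norm (t *\<^sub>R v)"
        using norm_triangle_ineq[of "z1 - zb - t *\<^sub>R v" "t *\<^sub>R v"] by simp
      moreover have "t * \<eta> \<le> t * 1" using t0 \<eta> by simp
      moreover have "norm (t *\<^sub>R v) = t * norm v" using t0 by simp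
      ultimately show ?thesis using z1 unfolding distrib_left by linarith
    qed
    also have "t * (norm v + 1) \<le> t * (norm v + 1 + \<alpha>)" using t0 \<alpha> by (intro mult_left_mono) auto
    finally have z1r: "norm (z1 - zb) \<le> r" using elim by linarith
    then have z1c: "(p, x1) \<in> cball zb r" by (simp add: z1px dist_norm norm_minus_commute)
    define X where "X = xs + t *\<^sub>R vs"
    obtain x2 where x2: "(p, x2) \<in> cball zb r" "x2 \<in> \<Gamma> p"
      "\<And>x. (p, x) \<in> cball zb r \<Longrightarrow> x \<in> \<Gamma> p \<Longrightarrow> norm (x1 + \<sigma> *\<^sub>R X - x2) \<le> norm (x1 + \<sigma> *\<^sub>R X - x)"
      using slice_closest[OF r(3) z1c, of "x1 + \<sigma> *\<^sub>R X" thesis] z1 by (auto simp: z1px gph_def)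
    define d where "d = x2 - x1"
    \<comment> \<open>The arc point \<open>x1\<close> competes in the projection, which bounds the
      squared displacement by its pairing with the shift.\<close>
    have "norm (\<sigma> *\<^sub>R X - d) \<le> norm (\<sigma> *\<^sub>R X)"
      using x2(3)[OF z1c] z1 by (simp add: z1px gph_def d_def algebra_simps)
    then have "(norm (\<sigma> *\<^sub>R X - d))\<^sup>2 \<le> (norm (\<sigma> *\<^sub>R X))\<^sup>2" by simp
    then have dX: "(norm d)\<^sup>2 \<le> 2 * \<sigma> * (X \<bullet> d)"
      unfolding power2_norm_eq_inner
      by (simp add: inner_diff_left inner_diff_right inner_commute algebra_simps)
    \<comment> \<open>A convex combination of \<open>\<mu>\<close>, \<open>\<mu>b\<close> and
      \<open>\<mu>b + e \<nu>\<close> with weights \<open>1 - \<theta>\<close>,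
      \<open>\<theta> - t / e\<close> and \<open>t / e\<close>, hence polar as soon as
      \<open>t \<le> \<theta> * e\<close>.\<close>
    define \<mu>t where "\<mu>t = (1 - \<theta>) *\<^sub>R \<mu> + \<theta> *\<^sub>R \<mu>b + t *\<^sub>R \<nu>"
    have \<mu>tK: "\<mu>t \<in> polar K"
    proof -
      have "\<mu>t = (1 - \<theta>) *\<^sub>R \<mu> + ((\<theta> - t / e) *\<^sub>R \<mu>b + (t / e) *\<^sub>R (\<mu>b + e *\<^sub>R \<nu>))"
        using \<nu> by (simp add: \<mu>t_def algebra_simps)
      moreover have "t / e \<le> \<theta>" using elim \<nu> by (simp add: divide_le_eq)
      ultimately show ?thesis using \<mu>(1) \<mu>b(1) \<nu> t0 \<theta>
        by (metis polar_add polar_scale diff_ge_0_iff_ge divide_nonneg_pos less_imp_le)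
    qed
    have \<mu>tm: "norm \<mu>t \<le> m"
    proof -
      have "norm \<mu>t \<le> norm ((1 - \<theta>) *\<^sub>R \<mu>) + norm (\<theta> *\<^sub>R \<mu>b) + norm (t *\<^sub>R \<nu>)"
        unfolding \<mu>t_def by (intro order_trans[OF norm_triangle_ineq] add_mono norm_triangle_ineq order_refl)
      also have "\<dots> \<le> norm \<mu> + norm \<mu>b + norm \<nu>"
        using \<theta> t0 t1 by (intro add_mono) (auto simp: mult_left_le_one_le)
      finally show ?thesis by (simp add: m_def)
    qed
    \<comment> \<open>\<open>\<mu>\<close> and \<open>\<mu>b\<close> represent the same
      \<open>xs\<close>, so mixing them leaves the first-order part unchanged. The mixing shows only
      in the second-order part, with the small factor \<open>t\<close>.\<close>
    have Xd: "X \<bullet> d = \<mu>t \<bullet> (G' zb (0, d) + t *\<^sub>R G'' v (0, d))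
        + t * ((\<theta> *\<^sub>R (\<mu> - \<mu>b) - t *\<^sub>R \<nu>) \<bullet> G'' v (0, d))"
    proof -
      have "\<mu>t \<bullet> G' zb (0, d) = xs \<bullet> d + t * (\<nu> \<bullet> G' zb (0, d))"
        using \<mu>(2)[of d] \<mu>b(2)[of d]
        by (simp add: \<mu>t_def inner_add_left left_diff_distrib)
      then show ?thesis
        by (simp add: X_def \<mu>t_def vs inner_add_left inner_diff_left inner_add_right algebra_simps)
    qed
    have nd: "norm (0::'p, d) = norm d" by (simp add: norm_prod_def)
    have err: "(\<theta> *\<^sub>R (\<mu> - \<mu>b) - t *\<^sub>R \<nu>) \<bullet> G'' v (0, d) \<le> (b1 * \<theta> + t * b1) * norm d"
    proof -
      have "norm (\<theta> *\<^sub>R (\<mu> - \<mu>b) - t *\<^sub>R \<nu>) \<le> \<theta> * norm (\<mu> - \<mu>b) + t * norm \<nu>"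
        using norm_triangle_ineq4[of "\<theta> *\<^sub>R (\<mu> - \<mu>b)" "t *\<^sub>R \<nu>"] \<theta> t0 by simp
      also have "\<dots> \<le> \<theta> * m + t * m"
      proof (intro add_mono mult_left_mono)
        show "norm (\<mu> - \<mu>b) \<le> m" "norm \<nu> \<le> m"
          using norm_triangle_ineq4[of \<mu> \<mu>b] norm_ge_zero[of \<mu>] norm_ge_zero[of \<mu>b] norm_ge_zero[of \<nu>]
          unfolding m_def by linarith+
      qed (use \<theta> t0 in auto)
      finally have 1: "norm (\<theta> *\<^sub>R (\<mu> - \<mu>b) - t *\<^sub>R \<nu>) \<le> (\<theta> + t) * m" by (simp add: algebra_simps)
      have 2: "norm (G'' v (0, d)) \<le> c * norm v * norm d"
        using norm_blinfun[of "DDG v" "(0, d)"] mult_right_mono[OF c(2)[of v] norm_ge_zero[of d]]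
        unfolding nd by linarith
      have "(\<theta> *\<^sub>R (\<mu> - \<mu>b) - t *\<^sub>R \<nu>) \<bullet> G'' v (0, d) \<le> ((\<theta> + t) * m) * (c * norm v * norm d)"
        using \<theta> t0 m by (intro order_trans[OF norm_cauchy_schwarz] mult_mono 1 2) auto
      also have "\<dots> = (b1 * \<theta> + t * b1) * norm d" by (simp add: b1_def algebra_simps)
      finally show ?thesis .
    qed
    have x2ball: "(p, x2) \<in> ball zb \<delta>" "(p, x2) \<in> ball zb \<rho>" using x2(1) r by auto
    have z1ball: "z1 \<in> ball zb \<delta>" using z1c r by (auto simp: z1px)
    have "\<mu>t \<bullet> (G' zb (0, d) + t *\<^sub>R G'' v (0, d))
        \<le> m * \<eta> * t\<^sup>2 + m * \<eta> * (3 * (norm v + 1) + c) * (t * norm d) + m * (c + 1) * (norm d)\<^sup>2"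
      using \<Gamma>_iff[OF x2ball(2)] x2(2)
      by (intro pairing_estimate[OF c \<eta>(1,2) \<delta>(2) near z1ball x2ball(1) _ \<mu>tK \<mu>tm _ l z1(2) t0])
        (auto simp: z1px d_def)
    moreover have "t * ((\<theta> *\<^sub>R (\<mu> - \<mu>b) - t *\<^sub>R \<nu>) \<bullet> G'' v (0, d)) \<le> (b1 * \<theta> + t * b1) * (t * norm d)"
      using mult_left_mono[OF err less_imp_le[OF t0]] by (simp add: algebra_simps)
    ultimately have Xd_le: "X \<bullet> d \<le> m * \<eta> * t\<^sup>2 + (\<eta> * b2 + b1 * \<theta> + t * b1) * (t * norm d)
        + m * (c + 1) * (norm d)\<^sup>2"
      unfolding Xd by (simp add: b2_def algebra_simps)
    \<comment> \<open>The three summands are budgeted as \<open>\<alpha> / 4\<close>,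
      \<open>\<alpha> / 8\<close> and \<open>\<alpha> / 8\<close>.\<close>
    define B where "B = \<eta> * b2 + b1 * \<theta> + t * b1"
    have B: "0 \<le> B" "B \<le> \<alpha> / 2" using \<eta> \<theta> elim b1 b2 t0 by (auto simp: B_def)
    have "(norm d)\<^sup>2 \<le> 2 * \<sigma> * (m * \<eta> * t\<^sup>2 + B * (t * norm d) + m * (c + 1) * (norm d)\<^sup>2)"
      unfolding B_def using \<sigma> by (intro order_trans[OF dX] mult_left_mono Xd_le) auto
    then have "2 * (norm d)\<^sup>2 \<le> (4 * \<sigma> * m) * (\<eta> * t\<^sup>2) + (4 * \<sigma>) * (B * (t * norm d))
        + (4 * \<sigma> * (m * (c + 1))) * (norm d)\<^sup>2"
      by (simp add: algebra_simps)
    also have "\<dots> \<le> 1 * (\<eta> * t\<^sup>2) + 1 * (B * (t * norm d)) + 1 * (norm d)\<^sup>2"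
      using \<sigma> \<sigma>m \<sigma>1 B \<eta> t0 by (intro add_mono mult_right_mono) auto
    finally have "(norm d)\<^sup>2 \<le> \<eta> * t\<^sup>2 + B * (t * norm d)" by simp
    then have nd\<alpha>: "norm d \<le> \<alpha> * t"
      using quadratic_bound[OF norm_ge_zero t0 \<alpha>(1) _ \<eta>(4) B(2)] by blast
    define z2 where "z2 = (p, x2)"
    have z21: "norm (z2 - z1) = norm d" by (simp add: z2_def z1px d_def norm_prod_def)
    have "norm (z2 - zb) \<le> norm (z2 - z1) + norm (z1 - zb)"
      using norm_triangle_ineq[of "z2 - z1" "z1 - zb"] by simp
    also have "\<dots> \<le> t * (norm v + 1 + \<alpha>)" using z21 nd\<alpha> z1b by (simp add: algebra_simps)
    also have "\<dots> < r" using elim by simp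
    finally have z2r: "norm (z2 - zb) < r" .
    define ys where "ys = (x1 + \<sigma> *\<^sub>R X - x2) /\<^sub>R \<sigma>"
    have "ys \<in> regular_normal (\<Gamma> p) x2"
      unfolding ys_def
    \<comment> \<open>The bound on \<open>d\<close> keeps \<open>z2\<close> strictly inside the ball
      of radius \<open>r\<close>, so the confined projection is a local projection onto the whole
      slice.\<close>
    proof (rule regular_normal_nearest[OF x2(2) \<sigma>(1), of "r - norm (z2 - zb)"])
      fix x' assume x': "x' \<in> \<Gamma> p" "dist x' x2 < r - norm (z2 - zb)"
      have "norm ((p, x') - zb) \<le> norm ((p, x') - z2) + norm (z2 - zb)"
        using norm_triangle_ineq[of "(p, x') - z2" "z2 - zb"] by simp
      also have "norm ((p, x') - z2) = dist x' x2" by (simp add: z2_def norm_prod_def dist_norm)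
      finally have "(p, x') \<in> cball zb r" using x' by (simp add: dist_norm norm_minus_commute)
      from x2(3)[OF this x'(1)]
      show "norm (x1 + \<sigma> *\<^sub>R X - x2) \<le> norm (x1 + \<sigma> *\<^sub>R X - x')" .
    qed (use z2r in simp)
    then have mem: "(z2, ys) \<in> gph \<Psi>" by (simp add: gph_def z2_def)
    have "ys - X = - (d /\<^sub>R \<sigma>)" using \<sigma>(1) by (simp add: ys_def d_def algebra_simps)
    then have "norm (ys - X) = norm d / \<sigma>" using \<sigma>(1) by (simp add: divide_inverse mult.commute)
    also have "\<dots> \<le> \<alpha> * t / \<sigma>" using nd\<alpha> \<sigma>(1) by (intro divide_right_mono) auto
    also have "\<dots> \<le> \<sigma> * \<epsilon> / 2 * t / \<sigma>" using \<alpha>(2) \<sigma>(1) t0 by (intro divide_right_mono mult_right_mono) auto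
    also have "\<dots> = t * (\<epsilon> / 2)" using \<sigma>(1) by simp
    finally have ysX: "norm (ys - xs - t *\<^sub>R vs) \<le> t * (\<epsilon> / 2)" by (simp add: X_def algebra_simps)
    have "norm (z2 - zb - t *\<^sub>R v) \<le> norm (z2 - z1) + norm (z1 - zb - t *\<^sub>R v)"
      using norm_triangle_ineq[of "z2 - z1" "z1 - zb - t *\<^sub>R v"] by (simp add: algebra_simps)
    also have "\<dots> \<le> t * \<alpha> + t * \<eta>" using z21 nd\<alpha> z1(2) by (simp add: mult.commute)
    also have "\<dots> \<le> t * (\<epsilon> / 4) + t * (\<epsilon> / 4)" using \<alpha> \<eta> t0 by (intro add_mono mult_left_mono) auto
    finally have z2v: "norm (z2 - zb - t *\<^sub>R v) \<le> t * (\<epsilon> / 2)" by (simp add: mult.commute)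
    define w' where "w' = ((z2 - zb) /\<^sub>R t, (ys - xs) /\<^sub>R t)"
    have "w' - (v, vs) = ((z2 - zb - t *\<^sub>R v) /\<^sub>R t, (ys - xs - t *\<^sub>R vs) /\<^sub>R t)"
      using t0 by (simp add: w'_def scaleR_diff_right)
    also have "norm \<dots> \<le> norm ((z2 - zb - t *\<^sub>R v) /\<^sub>R t) + norm ((ys - xs - t *\<^sub>R vs) /\<^sub>R t)"
      by (rule norm_Pair_le)
    also have "\<dots> = norm (z2 - zb - t *\<^sub>R v) / t + norm (ys - xs - t *\<^sub>R vs) / t"
      using t0 by (simp add: divide_inverse mult.commute)
    also have "\<dots> \<le> \<epsilon> / 2 + \<epsilon> / 2"
      using z2v ysX t0 by (intro add_mono) (auto simp: divide_le_eq mult.commute)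
    finally have "norm (w' - (v, vs)) \<le> \<epsilon>" by simp
    moreover have "(zb, xs) + t *\<^sub>R w' = (z2, ys)" using t0 by (simp add: w'_def)
    ultimately show ?case using t0 t\<epsilon> mem by metis
  qed
  then obtain t where "\<exists>w'. 0 < t \<and> t < \<epsilon> \<and> norm (w' - (v, vs)) \<le> \<epsilon> \<and> (zb, xs) + t *\<^sub>R w' \<in> gph \<Psi>"
    using eventually_happens' trivial_limit_at_right_real by blast
  then show "\<exists>t w'. 0 < t \<and> t < \<epsilon> \<and> norm (w' - (v, vs)) \<le> \<epsilon> \<and> (zb, xs) + t *\<^sub>R w' \<in> gph \<Psi>"
    by blast
qed

end

section \<open>Normals to the critical cone\<close>

context reduced_system
begin

lemma linear_G': "linear (G' z)"
  by (rule bounded_linear.linear[OF blinfun.bounded_linear_right])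

lemma adjoint_G': "adjoint (G' zb) \<mu> \<bullet> w = \<mu> \<bullet> G' zb w"
  using adjoint_works[OF linear_G', of w zb \<mu>] by (simp add: inner_commute)

lemma normal_tangentI:
  assumes "\<mu> \<in> polar K" "G' zb v \<in> K" "\<mu> \<bullet> G' zb v = 0"
  shows "adjoint (G' zb) \<mu> \<in> regular_normal (tangent_cone (gph \<Gamma>) zb) v"
  using assms
  by (intro regular_normalI) (auto simp: tangent_iff adjoint_G' inner_diff_right polar_def)

text \<open>The tangent set is a cone, so from \<open>v\<close> one can move radially outwards and
  inwards; the two tests give opposite inequalities.\<close>

lemma normal_tangentD:
  assumes n: "n \<in> regular_normal (tangent_cone (gph \<Gamma>) zb) v"
  shows "G' zb v \<in> K" "n \<bullet> v = 0"
proof -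
  have "v \<in> tangent_cone (gph \<Gamma>) zb" using n by (auto simp: regular_normal_def split: if_splits)
  then show vK: "G' zb v \<in> K" by (simp add: tangent_iff)
  then have scale: "c *\<^sub>R v \<in> tangent_cone (gph \<Gamma>) zb" if "c \<ge> 0" for c
    using K(3) that by (simp add: tangent_iff blinfun.scaleR_right cone_def)
  have "n \<bullet> v \<le> 0"
    by (rule regular_normal_ray[OF n]) (use scale[of "1 + _"] in \<open>simp add: algebra_simps\<close>)
  moreover have "n \<bullet> - v \<le> 0"
    by (rule regular_normal_ray[OF n]) (use scale[of "1 - _"] in \<open>simp add: algebra_simps\<close>)
  ultimately show "n \<bullet> v = 0" by simp
qed

text \<open>Every polar \<open>\<mu>\<close> vanishes on \<open>lin_cone K\<close>, so the critical
  cone contains the whole line through \<open>v\<close> in the direction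
  \<open>(0, u)\<close>.\<close>

lemma critical_normal_orthogonal:
  assumes n: "n \<in> regular_normal (critical_cone (gph \<Gamma>) zb (adjoint (G' zb) \<mu>)) v"
    and \<mu>: "\<mu> \<in> polar K" and v: "G' zb v \<in> lin_cone K" and u: "G' zb (0, u) \<in> lin_cone K"
  shows "snd n \<bullet> u = 0"
proof -
  have le: "n \<bullet> (0, u') \<le> 0" if "G' zb (0, u') \<in> lin_cone K" for u'
  proof (rule regular_normal_ray[OF n])
    fix \<tau> :: real
    have "G' zb (v + \<tau> *\<^sub>R (0, u')) \<in> lin_cone K"
      unfolding blinfun.add_right blinfun.scaleR_right
      by (intro subspace_add[OF lin_subspace v] subspace_scale[OF lin_subspace] that)
    then show "v + \<tau> *\<^sub>R (0, u') \<in> critical_cone (gph \<Gamma>) zb (adjoint (G' zb) \<mu>)"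
      using polar_lin_cone[OF \<mu>] unfolding critical_cone_def
      by (simp add: tangent_iff adjoint_G' mem_lin_cone_iff del: scaleR_Pair)
  qed
  have "G' zb (0, - u) \<in> lin_cone K"
    using subspace_neg[OF lin_subspace u] by (simp flip: blinfun.minus_right)
  from le[OF this] le[OF u] show ?thesis by (simp add: inner_prod_def)
qed

lemma critical_normalI:
  assumes \<mu>: "\<mu> \<in> polar K" and \<mu>b: "\<mu>b \<in> rel_interior (polar K)"
    and eq: "\<And>u. \<mu> \<bullet> G' zb (0, u) = \<mu>b \<bullet> G' zb (0, u)"
    and v: "G' zb v \<in> lin_cone K"
    and w: "\<And>u. G' zb (0, u) \<in> lin_cone K \<Longrightarrow> w \<bullet> u = 0"
  shows "w \<in> snd ` regular_normal (critical_cone (gph \<Gamma>) zb (adjoint (G' zb) \<mu>)) v"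
proof -
  have "linear (\<lambda>u. G' zb (0, u))"
    by (rule linearI) (simp_all flip: blinfun.add_right blinfun.scaleR_right)
  from orthogonal_preimage_lin_cone[OF K4 \<mu>b this w] obtain \<nu> e
    where \<nu>: "e > 0" "\<mu>b + e *\<^sub>R \<nu> \<in> polar K" "\<And>u. w \<bullet> u = \<nu> \<bullet> G' zb (0, u)" by blast
  \<comment> \<open>Subtracting \<open>\<mu>\<close> changes nothing on the critical cone, where its
    pairing is zero, so \<open>n\<close> is nonpositive there. On vectors \<open>(0, u)\<close> it
    cancels \<open>\<mu>b\<close>, which leaves exactly \<open>\<nu>\<close>, that is,
    \<open>w\<close>.\<close>
  define n where "n = adjoint (G' zb) ((\<mu>b + e *\<^sub>R \<nu> - \<mu>) /\<^sub>R e)"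
  have n: "n \<bullet> w' = ((\<mu>b + e *\<^sub>R \<nu>) \<bullet> G' zb w' - \<mu> \<bullet> G' zb w') / e" for w'
    by (simp add: n_def adjoint_G' inner_diff_left divide_inverse mult.commute)
  have "snd n \<bullet> u = w \<bullet> u" for u
  proof -
    have "snd n \<bullet> u = n \<bullet> (0, u)" by (simp add: inner_prod_def)
    also have "\<dots> = \<nu> \<bullet> G' zb (0, u)" unfolding n using \<nu>(1) by (simp add: inner_add_left eq)
    finally show ?thesis by (simp add: \<nu>(3))
  qed
  then have "snd n = w" by (metis vector_eq_rdot)
  moreover have "n \<in> regular_normal (critical_cone (gph \<Gamma>) zb (adjoint (G' zb) \<mu>)) v"
  proof (rule regular_normalI)
    show "v \<in> critical_cone (gph \<Gamma>) zb (adjoint (G' zb) \<mu>)"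
      using v polar_lin_cone[OF \<mu> v] by (simp add: critical_cone_def tangent_iff adjoint_G' mem_lin_cone_iff)
    fix w' assume "w' \<in> critical_cone (gph \<Gamma>) zb (adjoint (G' zb) \<mu>)"
    then have "G' zb w' \<in> K" "\<mu> \<bullet> G' zb w' = 0" by (auto simp: critical_cone_def tangent_iff adjoint_G')
    moreover have "n \<bullet> v = 0" unfolding n using polar_lin_cone[OF \<mu> v] polar_lin_cone[OF \<nu>(2) v] by simp
    ultimately show "n \<bullet> (w' - v) \<le> 0"
      using \<nu>(1,2) by (simp add: inner_diff_right) (simp add: n polar_def divide_nonpos_pos)
  qed
  ultimately show ?thesis by blast
qed

text \<open>Strict complementarity makes the critical cone of \<open>\<Gamma> (fst zb)\<close> at \<open>snd zb\<close> the subspace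
  \<open>{u. G' zb (0, u) \<in> lin_cone K}\<close>, and \<open>u' + snd v\<close> lies in that critical cone.\<close>

lemma characteristic_direction:
  assumes \<mu>: "\<mu> \<in> polar K" and \<mu>b: "\<mu>b \<in> rel_interior (polar K)"
    and eq: "\<And>u. \<mu> \<bullet> G' zb (0, u) = \<mu>b \<bullet> G' zb (0, u)"
    and v: "G' zb v \<in> K" "\<mu> \<bullet> G' zb v = 0"
    and q: "G' zb (fst v, 0) = G' zb (0, u') + l" "l \<in> lin_cone K"
  shows "G' zb v \<in> lin_cone K"
proof -
  have "G' zb v = G' zb ((fst v, 0) + (0, snd v))" by simp
  also have "\<dots> = G' zb (0, u') + l + G' zb (0, snd v)" by (simp only: blinfun.add_right q)
  also have "\<dots> = G' zb (0, u' + snd v) + l"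
    by (simp flip: blinfun.add_right)
  finally have split: "G' zb v = G' zb (0, u' + snd v) + l" .
  have "\<And>x y. x \<in> K \<Longrightarrow> y \<in> K \<Longrightarrow> x + y \<in> K" using K convex_cone by blast
  then have "G' zb v + - l \<in> K"
    using v(1) q(2) unfolding mem_lin_cone_iff by blast
  then have inK: "G' zb (0, u' + snd v) \<in> K" by (simp add: split)
  have "\<mu> \<bullet> G' zb (0, u' + snd v) = 0"
    using v(2) polar_lin_cone[OF \<mu> q(2)] by (simp add: split inner_add_right)
  then have "G' zb (0, u' + snd v) \<in> lin_cone K"
    using rel_interior_polar_critical[OF K4 \<mu>b inK] eq by simp
  then show ?thesis unfolding split by (rule subspace_add[OF lin_subspace _ q(2)])
qed

end

section \<open>Derivatives of the composition and of the partial adjoint\<close>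

lemma has_derivative_D1:
  "f differentiable (at x) \<Longrightarrow> (f has_derivative blinfun_apply (D1 f x)) (at x)"
  by (metis D1_def bounded_linear_Blinfun_apply frechet_derivative_works has_derivative_bounded_linear)

lemma frechet_derivative_D1:
  "f differentiable (at x) \<Longrightarrow> frechet_derivative f (at x) = blinfun_apply (D1 f x)"
  by (rule frechet_derivative_at[symmetric]) (rule has_derivative_D1)

lemma D1_compose:
  assumes g: "g differentiable (at z)" and h: "h differentiable (at (g z))"
  shows "(h \<circ> g) differentiable (at z)" "D1 (h \<circ> g) z = D1 h (g z) o\<^sub>L D1 g z"
proof -
  have "((h \<circ> g) has_derivative (blinfun_apply (D1 h (g z)) \<circ> blinfun_apply (D1 g z))) (at z)"
    by (rule diff_chain_at[OF has_derivative_D1[OF g] has_derivative_D1[OF h]])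
  then have "((h \<circ> g) has_derivative (blinfun_apply (D1 h (g z) o\<^sub>L D1 g z))) (at z)"
    by (rule has_derivative_eq_rhs) (simp add: fun_eq_iff)
  then show "(h \<circ> g) differentiable (at z)" "D1 (h \<circ> g) z = D1 h (g z) o\<^sub>L D1 g z"
    unfolding D1_def using frechet_derivative_at
    by (auto simp: differentiable_def blinfun_apply_inverse simp flip: frechet_derivative_at)
qed

text \<open>The chain rule expresses the derivative of the composition on an open set as a bilinear
  composition of operators, to which the product rule applies.\<close>

lemma D1_compose_differentiable:
  assumes S: "open S" "z \<in> S"
    and g: "\<And>z. z \<in> S \<Longrightarrow> g differentiable (at z)" and h: "\<And>z. z \<in> S \<Longrightarrow> h differentiable (at (g z))"
    and Dg: "D1 g differentiable (at z)" and Dh: "D1 h differentiable (at (g z))"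
  shows "D1 (h \<circ> g) differentiable (at z)"
proof -
  obtain g2 where g2: "(D1 g has_derivative g2) (at z)" using Dg by (auto simp: differentiable_def)
  obtain h2 where h2: "(D1 h has_derivative h2) (at (g z))" using Dh by (auto simp: differentiable_def)
  have "((\<lambda>z. D1 h (g z)) has_derivative (\<lambda>w. h2 (D1 g z w))) (at z)"
    using diff_chain_at[OF has_derivative_D1[OF g[OF S(2)]] h2] by (simp add: o_def)
  from bounded_bilinear.FDERIV[OF bounded_bilinear_blinfun_compose this g2]
  have "((\<lambda>z. D1 h (g z) o\<^sub>L D1 g z) has_derivative
      (\<lambda>w. (D1 h (g z) o\<^sub>L g2 w) + (h2 (D1 g z w) o\<^sub>L D1 g z))) (at z)" .
  then have "(D1 (h \<circ> g) has_derivative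
      (\<lambda>w. (D1 h (g z) o\<^sub>L g2 w) + (h2 (D1 g z w) o\<^sub>L D1 g z))) (at z)"
    by (rule has_derivative_transform_within_open[OF _ S]) (simp add: D1_compose g h)
  then show ?thesis by (auto simp: differentiable_def)
qed

lemma inner_partial_adjoint:
  fixes T :: "('p::euclidean_space \<times> 'x::euclidean_space) \<Rightarrow>\<^sub>L 'e::euclidean_space"
  shows "adjoint (\<lambda>u. blinfun_apply T (0, u)) \<mu> \<bullet> u = \<mu> \<bullet> blinfun_apply T (0, u)"
proof -
  have "linear (\<lambda>u. blinfun_apply T (0, u))"
    by (rule linearI) (simp_all flip: blinfun.add_right blinfun.scaleR_right)
  from adjoint_works[OF this, of u \<mu>] show ?thesis by (simp add: inner_commute)
qed

text \<open>For fixed \<open>\<mu>\<close> the partial adjoint is linear in the operator, as its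
  coordinates show. Thus it commutes with differentiation in the base point.\<close>

lemma bounded_linear_partial_adjoint:
  "bounded_linear (\<lambda>T :: ('p::euclidean_space \<times> 'x::euclidean_space) \<Rightarrow>\<^sub>L 'e::euclidean_space.
     adjoint (\<lambda>u. blinfun_apply T (0, u)) \<mu>)"
proof -
  have "adjoint (\<lambda>u. blinfun_apply T (0, u)) \<mu> = (\<Sum>b\<in>Basis. (\<mu> \<bullet> blinfun_apply T (0, b)) *\<^sub>R b)"
    for T :: "('p \<times> 'x) \<Rightarrow>\<^sub>L 'e"
    by (rule euclidean_eqI) (simp add: inner_partial_adjoint)
  moreover have "bounded_linear (\<lambda>T :: ('p \<times> 'x) \<Rightarrow>\<^sub>L 'e. \<Sum>b\<in>Basis. (\<mu> \<bullet> blinfun_apply T (0, b)) *\<^sub>R b)"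
    by (intro bounded_linear_sum bounded_linear_scaleR_const bounded_linear_inner_right_comp
        blinfun.bounded_linear_left)
  ultimately show ?thesis by simp
qed

lemma infdist_witness:
  assumes "S \<noteq> {}" "infdist x S \<le> a" "e > 0"
  obtains y where "y \<in> S" "dist x y < a + e"
proof -
  have "infdist x S < a + e" using assms by linarith
  then have "\<exists>y\<in>S. dist x y < a + e"
    using assms(1) by (simp add: infdist_notempty cINF_less_iff)
  then show thesis using that by blast
qed

theorem theorem4p4:
  fixes g :: "'p::euclidean_space \<times> 'x::euclidean_space \<Rightarrow> 'y::euclidean_space"
    and C :: "'y set" and h :: "'y \<Rightarrow> 'e::euclidean_space" and K :: "'e set" and V :: "'y set"
    and pb :: 'p and xb :: 'x and xbs :: 'x
    and U0 :: "('p \<times> 'x) set"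
    and G :: "'p \<times> 'x \<Rightarrow> 'e" and \<Gamma> :: "'p \<Rightarrow> 'x set" and \<Psi> :: "'p \<times> 'x \<Rightarrow> 'x set"
    and zb :: "'p \<times> 'x" and Pc :: "'p set"
    and M :: "'p \<times> 'x \<Rightarrow> 'e set"
  defines "zb \<equiv> (pb, xb)"
    and "\<Gamma> \<equiv> (\<lambda>p. {x. g (p, x) \<in> C})"
    and "\<Psi> \<equiv> (\<lambda>(p, x). regular_normal (\<Gamma> p) x)"
    and "G \<equiv> h \<circ> g"
    and "M \<equiv> (\<lambda>zs. {\<mu> \<in> polar K. adjoint (frechet_derivative G (at zb)) \<mu> = zs})"
    and "Pc \<equiv> {q. frechet_derivative G (at zb) (q, 0)
                 \<in> setplus (range (\<lambda>u. frechet_derivative G (at zb) (0, u))) (lin_cone K)}"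
  assumes g_C2: "C2_on U0 g" and zb_U0: "zb \<in> U0"
    and C_closed: "closed C"
    and K_cone: "closed K" "convex K" "cone K"
    and h_C2: "C2_on V h" and gzb_V: "g zb \<in> V"
    and h_zero: "h (g zb) = 0"
    and h_surj: "surj (frechet_derivative h (at (g zb)))"
    and C_red: "C \<inter> V = {y \<in> V. h y \<in> K}"
    and xb_in: "xb \<in> \<Gamma> pb"
    and xbs_in: "xbs \<in> regular_normal (\<Gamma> pb) xb"
    and RS: "robinson_stable G K {z. g z \<in> V} pb xb"
    and SC: "\<exists>\<mu>\<in>rel_interior (polar K).
               adjoint (\<lambda>u. frechet_derivative G (at zb) (0, u)) \<mu> = xbs"
  shows "\<forall>v. fst v \<in> Pc \<longrightarrow>
           graphical_derivative \<Psi> zb xbs v \<subseteq>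
           \<Union> {(\<lambda>w. frechet_derivative (\<lambda>z. adjoint (\<lambda>u. frechet_derivative G (at z) (0, u)) \<mu>) (at zb) v + w)
                 ` (snd ` regular_normal (critical_cone (gph \<Gamma>) zb zs) v)
               | zs \<mu>. zs \<in> regular_normal (tangent_cone (gph \<Gamma>) zb) v \<and> snd zs = xbs \<and> \<mu> \<in> M zs}
         \<and> (\<forall>v. fst v \<in> Pc \<longrightarrow>
             blinfun_apply (D2 G zb v) v
               \<in> setplus (range (frechet_derivative G (at zb))) (lin_cone K) \<longrightarrow>
           graphical_derivative \<Psi> zb xbs v =
           \<Union> {(\<lambda>w. frechet_derivative (\<lambda>z. adjoint (\<lambda>u. frechet_derivative G (at z) (0, u)) \<mu>) (at zb) v + w)
                 ` (snd ` regular_normal (critical_cone (gph \<Gamma>) zb zs) v)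
               | zs \<mu>. zs \<in> regular_normal (tangent_cone (gph \<Gamma>) zb) v \<and> snd zs = xbs \<and> \<mu> \<in> M zs})"
proof -
  define A where "A = frechet_derivative G (at zb)"
  obtain \<kappa> W U where \<kappa>: "\<kappa> \<ge> 0" and WU: "open W" "pb \<in> W" "open U" "xb \<in> U" "W \<times> U \<subseteq> {z. g z \<in> V}"
    and RS': "\<forall>p\<in>W. \<forall>x\<in>U. {x'. (p, x') \<in> {z. g z \<in> V} \<and> G (p, x') \<in> K} \<noteq> {} \<and>
        infdist x {x'. (p, x') \<in> {z. g z \<in> V} \<and> G (p, x') \<in> K} \<le> \<kappa> * infdist (G (p, x)) K"
    using RS unfolding robinson_stable_def by (elim exE conjE) (rule that; assumption)
  \<comment> \<open>\<open>U0\<close> supplies differentiability of \<open>g\<close>;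
    \<open>W \<times> U\<close> supplies Robinson stability and keeps \<open>g z\<close> in the
    domain of \<open>h\<close>.\<close>
  have "open (U0 \<inter> W \<times> U)" using WU g_C2 by (auto simp: C2_on_def intro!: open_Int open_Times)
  moreover have "zb \<in> U0 \<inter> W \<times> U" using WU zb_U0 by (simp add: zb_def)
  ultimately obtain \<rho> where \<rho>: "\<rho> > 0" "ball zb \<rho> \<subseteq> U0 \<inter> W \<times> U" by (rule openE)
  have gV: "g z \<in> V" if "z \<in> ball zb \<rho>" for z
    using subsetD[OF WU(5), of z] subsetD[OF \<rho>(2) that] by simp
  have g_diff: "g differentiable (at z)" and h_diff: "h differentiable (at (g z))" if "z \<in> ball zb \<rho>" for z
    using \<rho> that gV[OF that] g_C2 h_C2 by (auto simp: C2_on_def)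
  have zb_ball: "zb \<in> ball zb \<rho>" using \<rho> by simp
  have G_diff: "G differentiable (at z)" if "z \<in> ball zb \<rho>" for z
    unfolding G_def by (rule D1_compose(1)[OF g_diff[OF that] h_diff[OF that]])
  have DG_diff: "D1 G differentiable (at zb)"
    unfolding G_def
    using g_C2 h_C2 zb_U0 gzb_V
    by (intro D1_compose_differentiable[OF open_ball zb_ball g_diff h_diff]) (auto simp: C2_on_def)
  have in_\<Gamma>: "x \<in> \<Gamma> p \<longleftrightarrow> G (p, x) \<in> K" if "g (p, x) \<in> V" for p x
    using C_red that by (auto simp: \<Gamma>_def G_def)
  interpret reduced_system G "D1 G" "D2 G zb" K \<Gamma> zb \<rho> \<kappa>
  proof
    show "(G has_derivative blinfun_apply (D1 G z)) (at z)" if "z \<in> ball zb \<rho>" for z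
      by (rule has_derivative_D1[OF G_diff[OF that]])
    show "(D1 G has_derivative D2 G zb) (at zb)"
      unfolding D2_def using DG_diff by (simp add: frechet_derivative_works)
    show "snd z \<in> \<Gamma> (fst z) \<longleftrightarrow> G z \<in> K" if "z \<in> ball zb \<rho>" for z
      using in_\<Gamma>[of "fst z" "snd z"] gV[OF that] by simp
    show "\<exists>x\<in>\<Gamma> (fst z). norm (x - snd z) \<le> \<kappa> * infdist (G z) K + e" if z: "z \<in> ball zb \<rho>" and e: "e > 0" for z e
    proof -
      have "fst z \<in> W" "snd z \<in> U" using subsetD[OF \<rho>(2) z] by auto
      then have "{x'. (fst z, x') \<in> {z. g z \<in> V} \<and> G (fst z, x') \<in> K} \<noteq> {}"
        "infdist (snd z) {x'. (fst z, x') \<in> {z. g z \<in> V} \<and> G (fst z, x') \<in> K} \<le> \<kappa> * infdist (G z) K"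
        using RS' by fastforce+
      from infdist_witness[OF this e] obtain x'
        where "g (fst z, x') \<in> V" "G (fst z, x') \<in> K" "dist (snd z) x' < \<kappa> * infdist (G z) K + e" by auto
      then show ?thesis using in_\<Gamma>[of "fst z" x'] by (auto simp: dist_norm norm_minus_commute intro!: bexI[of _ x'])
    qed
  qed (use K_cone \<rho> \<kappa> h_zero xb_in in \<open>auto simp: G_def zb_def\<close>)
  have A: "A = blinfun_apply (D1 G zb)"
    unfolding A_def by (rule frechet_derivative_D1[OF G_diff[OF zb_ball]])
  have \<Psi>: "\<Psi> = (\<lambda>(p, x). regular_normal (\<Gamma> p) x)" by (simp add: \<Psi>_def)
  obtain \<mu>b where \<mu>b: "\<mu>b \<in> rel_interior (polar K)" "adjoint (\<lambda>u. A (0, u)) \<mu>b = xbs"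
    using SC unfolding A_def by blast
  have \<mu>bK: "\<mu>b \<in> polar K" using \<mu>b(1) rel_interior_subset by blast
  have \<mu>b_eq: "xbs \<bullet> u = \<mu>b \<bullet> A (0, u)" for u
    using \<mu>b(2) inner_partial_adjoint[of "D1 G zb" \<mu>b u] by (simp add: A)
  define \<Phi> where "\<Phi> \<mu> v =
    frechet_derivative (\<lambda>z. adjoint (\<lambda>u. frechet_derivative G (at z) (0, u)) \<mu>) (at zb) v" for \<mu> v
  have \<Phi>: "\<Phi> \<mu> v \<bullet> u = \<mu> \<bullet> D2 G zb v (0, u)" for \<mu> v u
  proof -
    have "((\<lambda>z. adjoint (\<lambda>u. blinfun_apply (D1 G z) (0, u)) \<mu>) has_derivative
        (\<lambda>v. adjoint (\<lambda>u. blinfun_apply (D2 G zb v) (0, u)) \<mu>)) (at zb)"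
      by (rule bounded_linear.has_derivative[OF bounded_linear_partial_adjoint DG_deriv])
    then have "((\<lambda>z. adjoint (\<lambda>u. frechet_derivative G (at z) (0, u)) \<mu>) has_derivative
        (\<lambda>v. adjoint (\<lambda>u. blinfun_apply (D2 G zb v) (0, u)) \<mu>)) (at zb)"
      by (rule has_derivative_transform_within_open[OF _ open_ball zb_ball])
        (simp add: frechet_derivative_D1 G_diff)
    from fun_cong[OF frechet_derivative_at[OF this], of v]
    have "\<Phi> \<mu> v = adjoint (\<lambda>u. blinfun_apply (D2 G zb v) (0, u)) \<mu>" unfolding \<Phi>_def by (rule sym)
    then show ?thesis by (simp only: inner_partial_adjoint)
  qed
  have snd_adjoint: "snd (adjoint A \<mu>) \<bullet> u = \<mu> \<bullet> A (0, u)" for \<mu> u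
    using adjoint_G'[of \<mu> "(0, u)"] by (simp add: A inner_prod_def)
  define N where "N v zs = snd ` regular_normal (critical_cone (gph \<Gamma>) zb zs) v" for v zs
  define F where "F v = \<Union> {(\<lambda>w. \<Phi> \<mu> v + w) ` N v zs
      | zs \<mu>. zs \<in> regular_normal (tangent_cone (gph \<Gamma>) zb) v \<and> snd zs = xbs \<and> \<mu> \<in> M zs}" for v
  have char: "A v \<in> lin_cone K"
    if q: "fst v \<in> Pc" and \<mu>: "\<mu> \<in> polar K" "\<And>u. xbs \<bullet> u = \<mu> \<bullet> A (0, u)" and v: "A v \<in> K" "\<mu> \<bullet> A v = 0"
    for v \<mu>
  proof -
    obtain u' l where "A (fst v, 0) = A (0, u') + l" "l \<in> lin_cone K"
      using q by (auto simp: Pc_def setplus_def A_def)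
    then show ?thesis
      using characteristic_direction[OF \<mu>(1) \<mu>b(1), of v u' l] v \<mu>(2) \<mu>b_eq unfolding A by metis
  qed
  have incl: "graphical_derivative \<Psi> zb xbs v \<subseteq> F v" if q: "fst v \<in> Pc" for v
  proof
    fix vs assume "vs \<in> graphical_derivative \<Psi> zb xbs v"
    then obtain \<mu> where \<mu>: "\<mu> \<in> polar K" "\<And>u. xbs \<bullet> u = \<mu> \<bullet> A (0, u)" "A v \<in> K" "\<mu> \<bullet> A v = 0"
      "\<And>u. A (0, u) \<in> lin_cone K \<Longrightarrow> vs \<bullet> u = \<mu> \<bullet> D2 G zb v (0, u)"
      unfolding \<Psi> A by (rule graphical_derivative_multiplier) blast
    have Av: "A v \<in> lin_cone K" by (rule char[OF q \<mu>(1-4)])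
    \<comment> \<open>Removing the curvature term leaves a vector orthogonal to all \<open>u\<close>
      with \<open>A (0, u)\<close> in \<open>lin_cone K\<close>; such vectors are projected critical
      normals.\<close>
    have "vs - \<Phi> \<mu> v \<in> N v (adjoint A \<mu>)"
      unfolding N_def A
      by (rule critical_normalI[OF \<mu>(1) \<mu>b(1)])
        (use \<mu>(2,5) \<mu>b_eq Av in \<open>simp_all add: A inner_diff_left \<Phi>\<close>)
    moreover have "adjoint A \<mu> \<in> regular_normal (tangent_cone (gph \<Gamma>) zb) v"
      using normal_tangentI[of \<mu> v] \<mu> by (simp add: A)
    moreover have "snd (adjoint A \<mu>) = xbs"
      by (rule vector_eq_rdot[THEN iffD1]) (simp add: snd_adjoint \<mu>(2))
    moreover have "\<mu> \<in> M (adjoint A \<mu>)" using \<mu>(1) by (simp add: M_def A_def)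
    moreover have "vs = \<Phi> \<mu> v + (vs - \<Phi> \<mu> v)" by simp
    ultimately show "vs \<in> F v" unfolding F_def by blast
  qed
  have conv: "F v \<subseteq> graphical_derivative \<Psi> zb xbs v"
    if q: "fst v \<in> Pc" and so: "D2 G zb v v \<in> setplus (range A) (lin_cone K)" for v
  proof
    fix vs assume "vs \<in> F v"
    then obtain zs \<mu> n where zs: "zs \<in> regular_normal (tangent_cone (gph \<Gamma>) zb) v" "snd zs = xbs"
      and \<mu>M: "\<mu> \<in> M zs" and n: "n \<in> regular_normal (critical_cone (gph \<Gamma>) zb zs) v" and vs: "vs = \<Phi> \<mu> v + snd n"
      unfolding F_def N_def by blast
    have \<mu>: "\<mu> \<in> polar K" "zs = adjoint A \<mu>" using \<mu>M by (auto simp: M_def A_def)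
    have \<mu>_eq: "xbs \<bullet> u = \<mu> \<bullet> A (0, u)" for u using snd_adjoint[of \<mu> u] zs(2) \<mu>(2) by simp
    have v: "A v \<in> K" "\<mu> \<bullet> A v = 0"
      using normal_tangentD[OF zs(1)] adjoint_G'[of \<mu> v] \<mu>(2) by (simp_all add: A)
    have Av: "A v \<in> lin_cone K" by (rule char[OF q \<mu>(1) \<mu>_eq v])
    have perp: "snd n \<bullet> u = 0" if "A (0, u) \<in> lin_cone K" for u
      using critical_normal_orthogonal[OF _ \<mu>(1), of n v u] n Av that by (simp add: A \<mu>(2))
    have "linear (\<lambda>u. A (0, u))"
      unfolding A by (rule linearI) (simp_all flip: blinfun.add_right blinfun.scaleR_right)
    from orthogonal_preimage_lin_cone[OF K4 \<mu>b(1) this perp] obtain \<nu> e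
      where \<nu>: "e > 0" "\<mu>b + e *\<^sub>R \<nu> \<in> polar K" "\<And>u. snd n \<bullet> u = \<nu> \<bullet> A (0, u)" by blast
    obtain s l where "D2 G zb v v = A s + l" "l \<in> lin_cone K" using so by (auto simp: setplus_def)
    \<comment> \<open>The arc has to cancel the curvature modulo \<open>lin_cone K\<close>, hence
      the sign change of \<open>s\<close>.\<close>
    then have s: "A (- s) + D2 G zb v v \<in> lin_cone K" by (simp add: A blinfun.minus_right)
    show "vs \<in> graphical_derivative \<Psi> zb xbs v"
      unfolding \<Psi>
      by (rule graphical_derivativeI[OF \<mu>(1) _ \<mu>bK _ \<nu>(1,2) _ s[unfolded A]])
        (use \<mu>_eq \<mu>b_eq Av \<nu>(3) in \<open>simp_all add: A vs inner_add_left \<Phi>\<close>)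
  qed
  have eq: "graphical_derivative \<Psi> zb xbs v = F v"
    if "fst v \<in> Pc" "D2 G zb v v \<in> setplus (range (frechet_derivative G (at zb))) (lin_cone K)" for v
    using incl[OF that(1)] conv[OF that(1)] that(2) by (simp add: A_def)
  show ?thesis
    using incl eq unfolding F_def N_def \<Phi>_def by blast
qed

end
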